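(* Let $f:\mathbb{T}\to\mathbb{R}$ be an even function satisfying $\widehat f(k)\ge c|k|^{-2}$ for some fixed constant $c>0$ and all $k\in\mathbb{Z}$, $k\neq 0$. Starting from an arbitrary finite initial set $\{x_1,\dots,x_m\}\subset\mathbb{T}$, define a sequence $(x_n)_{n\ge 1}$ via $$x_n=\arg\min_{x\in\mathbb{T}}\sum_{k=1}^{n-1}f(x-x_k)\qquad (n>m).$$ Then this sequence satisfies $$W_2\left(\frac1n\sum_{k=1}^n\delta_{x_k},\,dx\right)\lesssim\frac{1}{n^{1/2}},$$ where the implicit constant depends only on the initial set, $f(0)$ and $c$.
   Context: $\mathbb{T}=\mathbb{R}/\mathbb{Z}\cong[0,1]$ (endpoints identified) is the one-dimensional torus with Lebesgue probability measure $dx$ and its usual metric; $\widehat f(k)=\int_{\mathbb{T}}f(x)e^{-2\pi i kx}\,dx$. If the minimum is not attained at a unique point, any of the minimizing points may be chosen. $A\lesssim B$ means $A\le C B$ for a constant $C>0$ (the implicit constant), uniformly in $n$. For probability measures $\mu,\nu$ on a metric space $M$, the $2$-Wasserstein distance is $$W_2(\mu,\nu)=\left(\inf_{\gamma\in\Gamma(\mu,\nu)}\int_{M\times M}|x-y|^2\,d\gamma(x,y)\right)^{1/2},$$ where $|x-y|$ denotes the distance and $\Gamma(\mu,\nu)$ is the set of measures on $M\times M$ with marginals $\mu$ and $\nu$.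
   Formalization: f is assumed continuous (changing f only at 0 refutes the claim otherwise); the constant depends on the initial set, c and f(0) minus the mean of f, and on f(0) itself only when the mean is ≥ 0, since adding constants to f makes dependence on f(0) alone false. *)

theory Defs
  imports "HOL-Probability.Probability"
begin

section \<open>The torus $\mathbb{R}/\mathbb{Z}$\<close>

quotient_type torus = real / "\<lambda>x y :: real. x - y \<in> \<int>"
  morphisms torus_rep to_torus
proof (rule equivpI)
  show "reflp (\<lambda>x y :: real. x - y \<in> \<int>)"
    by (simp add: reflp_def)
  show "symp (\<lambda>x y :: real. x - y \<in> \<int>)"
    unfolding symp_def by (metis Ints_minus minus_diff_eq)
  show "transp (\<lambda>x y :: real. x - y \<in> \<int>)"
    unfolding transp_def by (metis Ints_add diff_add_cancel add_diff_eq)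
qed

instantiation torus :: ab_group_add
begin

lift_definition zero_torus :: torus is "0 :: real" .

lift_definition plus_torus :: "torus \<Rightarrow> torus \<Rightarrow> torus" is "(+) :: real \<Rightarrow> real \<Rightarrow> real"
  by (metis Ints_add add_diff_add)

lift_definition uminus_torus :: "torus \<Rightarrow> torus" is "uminus :: real \<Rightarrow> real"
  by (metis Ints_minus minus_diff_commute minus_diff_minus)

lift_definition minus_torus :: "torus \<Rightarrow> torus \<Rightarrow> torus" is "(-) :: real \<Rightarrow> real \<Rightarrow> real"
  by (metis Ints_diff diff_diff_eq2 diff_add_eq add_diff_eq diff_diff_add add.commute)

instance
  by standard (transfer, simp add: algebra_simps)+

end

text \<open>The quotient metric: the smallest \<open>\<bar>x - y - k\<bar>\<close> over integers \<open>k\<close>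
  (\<open>dist_to_int_le\<close>, \<open>dist_to_int_attained\<close>).\<close>

definition dist_to_int :: "real \<Rightarrow> real" where
  "dist_to_int t = \<bar>t - of_int (round t)\<bar>"

lemma dist_to_int_le: "dist_to_int t \<le> \<bar>t - of_int k\<bar>"
  unfolding dist_to_int_def by (rule round_diff_minimal)

lemma dist_to_int_attained: "\<exists>k :: int. dist_to_int t = \<bar>t - of_int k\<bar>"
  unfolding dist_to_int_def by blast

lemma dist_to_int_shift:
  assumes "s - t \<in> \<int>"
  shows "dist_to_int s = dist_to_int t"
proof -
  have le: "dist_to_int s \<le> dist_to_int t" if "s - t \<in> \<int>" for s t :: real
  proof -
    from that obtain j :: int where j: "s - t = of_int j" by (auto elim: Ints_cases)
    obtain k :: int where k: "dist_to_int t = \<bar>t - of_int k\<bar>"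
      using dist_to_int_attained by blast
    have "dist_to_int s \<le> \<bar>s - of_int (k + j)\<bar>" by (rule dist_to_int_le)
    also have "s - of_int (k + j) = t - of_int k" using j by simp
    finally show ?thesis using k by simp
  qed
  have "t - s \<in> \<int>" using assms by (metis Ints_minus minus_diff_eq)
  then show ?thesis using le[of s t] le[of t s] assms by simp
qed

instantiation torus :: metric_space
begin

lift_definition dist_torus :: "torus \<Rightarrow> torus \<Rightarrow> real" is "\<lambda>x y. dist_to_int (x - y)"
proof -
  fix a b c d :: real
  assume "a - b \<in> \<int>" "c - d \<in> \<int>"
  then have "(a - b) - (c - d) \<in> \<int>" by (rule Ints_diff)
  then have "(a - c) - (b - d) \<in> \<int>" by (simp add: algebra_simps)
  then show "dist_to_int (a - c) = dist_to_int (b - d)" by (rule dist_to_int_shift)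
qed

definition uniformity_torus :: "(torus \<times> torus) filter" where
  "uniformity_torus = (INF e\<in>{0 <..}. principal {(x, y). dist x y < e})"

definition open_torus :: "torus set \<Rightarrow> bool" where
  "open_torus U \<longleftrightarrow> (\<forall>x\<in>U. eventually (\<lambda>(x', y). x' = x \<longrightarrow> y \<in> U) uniformity)"

instance
proof
  show "(uniformity :: (torus \<times> torus) filter) = (INF e\<in>{0 <..}. principal {(x, y). dist x y < e})"
    by (rule uniformity_torus_def)
  show "open U \<longleftrightarrow> (\<forall>x\<in>U. eventually (\<lambda>(x', y). x' = x \<longrightarrow> y \<in> U) uniformity)"
    for U :: "torus set" by (rule open_torus_def)
  show "dist x y = 0 \<longleftrightarrow> x = y" for x y :: torus
  proof transfer
    fix s t :: real
    have "dist_to_int (s - t) = 0 \<longleftrightarrow> s - t = of_int (round (s - t))"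
      unfolding dist_to_int_def by simp
    also have "\<dots> \<longleftrightarrow> s - t \<in> \<int>"
      by (metis Ints_of_int Ints_cases round_of_int)
    finally show "dist_to_int (s - t) = 0 \<longleftrightarrow> s - t \<in> \<int>" .
  qed
  show "dist x y \<le> dist x z + dist y z" for x y z :: torus
  proof transfer
    fix r s t :: real
    obtain j :: int where j: "dist_to_int (r - t) = \<bar>r - t - of_int j\<bar>"
      using dist_to_int_attained by blast
    obtain k :: int where k: "dist_to_int (s - t) = \<bar>s - t - of_int k\<bar>"
      using dist_to_int_attained by blast
    have "dist_to_int (r - s) \<le> \<bar>r - s - of_int (j - k)\<bar>" by (rule dist_to_int_le)
    also have "\<dots> \<le> \<bar>r - t - of_int j\<bar> + \<bar>s - t - of_int k\<bar>" by simp
    finally show "dist_to_int (r - s) \<le> dist_to_int (r - t) + dist_to_int (s - t)"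
      using j k by simp
  qed
qed

end

lemma continuous_on_to_torus: "continuous_on A to_torus"
proof -
  have "dist (to_torus s) (to_torus t) \<le> dist s t" for s t :: real
    using dist_to_int_le[of "s - t" 0] by (simp add: dist_torus.abs_eq dist_real_def)
  then show ?thesis unfolding continuous_on_iff by (meson le_less_trans)
qed

lemma measurable_to_torus [measurable]: "to_torus \<in> borel_measurable borel"
  by (intro borel_measurable_continuous_onI continuous_on_to_torus)

definition torus_measure :: "torus measure" where
  "torus_measure = distr (restrict_space lborel {0..<1}) borel to_torus"

lemma prob_space_torus_measure: "prob_space torus_measure"
proof -
  have m: "to_torus \<in> measurable (restrict_space lborel {0..<1}) borel"
    by (intro measurable_restrict_space1) simp
  show ?thesis unfolding torus_measure_def
    by (intro prob_space.prob_space_distr[OF _ m] prob_spaceI)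
      (simp add: space_restrict_space emeasure_restrict_space)
qed

section \<open>Fourier coefficients\<close>

lift_definition torus_char :: "int \<Rightarrow> torus \<Rightarrow> complex" is
  "\<lambda>k x. exp (2 * of_real pi * \<i> * of_int k * of_real x)"
proof -
  fix k :: int and x y :: real
  assume "x - y \<in> \<int>"
  then obtain j :: int where "x = y + of_int j"
    by (metis Ints_cases add_diff_cancel_left' add_diff_eq diff_add_cancel add.commute)
  then have "2 * of_real pi * \<i> * of_int k * complex_of_real x
      = 2 * of_real pi * \<i> * of_int k * of_real y + 2 * of_int (k * j) * of_real pi * \<i>"
    by (simp add: algebra_simps)
  moreover have "exp (2 * of_int (k * j) * of_real pi * \<i>) = (1 :: complex)"
    using exp_2pi_1_int[of "k * j"] by (simp only: mult_ac)
  ultimately show "exp (2 * of_real pi * \<i> * of_int k * complex_of_real x)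
      = exp (2 * of_real pi * \<i> * of_int k * of_real y)"
    by (simp only: exp_add mult_1_right)
qed

text \<open>For real-valued even \<open>f\<close> all coefficients are real; inequalities between
  coefficients and real numbers are stated through \<^const>\<open>Re\<close>.\<close>

definition fourier_coeff :: "(torus \<Rightarrow> real) \<Rightarrow> int \<Rightarrow> complex" where
  "fourier_coeff f k = (\<integral>x. of_real (f x) * torus_char (- k) x \<partial>torus_measure)"

section \<open>The 2-Wasserstein distance\<close>

text \<open>Couplings live on the Borel sets of the product space, so that the distance is measurable on
  every metric space. On a second countable space such as the torus this is the product
  sigma-algebra of the Borel sets. Values are in \<^typ>\<open>ennreal\<close>, since the infimum of
  the costs may be infinite on an unbounded space.\<close>

definition couplings :: "'a :: metric_space measure \<Rightarrow> 'a measure \<Rightarrow> ('a \<times> 'a) measure set" where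
  "couplings \<mu> \<nu> = {\<gamma>. sets \<gamma> = sets borel \<and> distr \<gamma> borel fst = \<mu> \<and> distr \<gamma> borel snd = \<nu>}"

definition wasserstein2 :: "'a :: metric_space measure \<Rightarrow> 'a measure \<Rightarrow> ennreal" where
  "wasserstein2 \<mu> \<nu> =
    (let I = (INF \<gamma>\<in>couplings \<mu> \<nu>. \<integral>\<^sup>+z. ennreal ((dist (fst z) (snd z))\<^sup>2) \<partial>\<gamma>)
     in if I = \<infinity> then \<infinity> else ennreal (sqrt (enn2real I)))"

definition empirical_measure :: "(nat \<Rightarrow> 'a :: topological_space) \<Rightarrow> nat \<Rightarrow> 'a measure" where
  "empirical_measure x n = distr (uniform_count_measure {1..n}) borel x"

lemma emeasure_empirical_measure:
  assumes "n \<ge> 1" "A \<in> sets borel"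
  shows "emeasure (empirical_measure x n) A = (\<Sum>k=1..n. emeasure (return borel (x k)) A) / of_nat n"
proof -
  have m: "x \<in> measurable (uniform_count_measure {1..n}) borel"
    by (simp add: measurable_def space_uniform_count_measure sets_uniform_count_measure)
  have "emeasure (empirical_measure x n) A = ennreal (card (x -` A \<inter> {1..n}) / card {1..n})"
    unfolding empirical_measure_def
    by (subst emeasure_distr[OF m assms(2)])
      (simp add: space_uniform_count_measure emeasure_uniform_count_measure del: One_nat_def)
  also have "\<dots> = ennreal (real (card (x -` A \<inter> {1..n}))) / of_nat n"
    using assms(1) by (simp add: divide_ennreal[symmetric] ennreal_of_nat_eq_real_of_nat)
  also have "ennreal (real (card (x -` A \<inter> {1..n}))) = (\<Sum>k=1..n. indicator A (x k))"
    by (simp add: indicator_def sum.If_cases ennreal_of_nat_eq_real_of_nat[symmetric]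
        Int_def vimage_def conj_commute)
  finally show ?thesis using assms(2) by simp
qed

end

theory Submission
  imports Defs
begin

text \<open>The empirical measure and Lebesgue measure are compared through one quadratic energy.  Let \<open>B\<close>
be the periodic Bernoulli polynomial, \<open>B(t) = {t}\<^sup>2 - {t} + 1/6\<close> with \<open>{t}\<close> the fractional
part, whose Fourier coefficients are \<open>1/(2\<pi>\<^sup>2k\<^sup>2)\<close> for \<open>k \<noteq> 0\<close> and \<open>0\<close> for \<open>k = 0\<close>.

Upper bound for an energy.  Put \<open>g = f - \<integral>f\<close>.  Since \<open>g\<close> has mean zero, the minimum over \<open>t\<close>
of \<open>\<Sum>k<n. g(t - x\<^sub>k)\<close> is at most \<open>0\<close>.  Hence each greedy step adds at most \<open>g(0)\<close>
to \<open>\<Sum>k,l\<le>n. g(x\<^sub>k - x\<^sub>l)\<close>: twice a nonpositive interaction with the old points, as \<open>g\<close> is even,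
plus the diagonal term.  So this energy grows linearly in \<open>n\<close>, and the initial points only affect
the constant (\<open>greedy_energy_le\<close>).

Comparison of energies.  The hypothesis on \<open>f\<close> says that \<open>g - 2\<pi>\<^sup>2c B\<close> is a continuous function
with nonnegative Fourier coefficients.  Such a function is positive definite
(\<open>nonneg_fourier_imp_positive_definite\<close>), because its Fejer means are nonnegative combinations of
characters and converge to it pointwise.  Thus \<open>2\<pi>\<^sup>2c \<Sum>k,l. B(x\<^sub>k - x\<^sub>l)\<close> is also \<open>O(n)\<close>.

From energy to transport.  On the circle, \<open>W\<^sub>2\<^sup>2 \<le> (1/2n\<^sup>2) \<Sum>k,l. B(x\<^sub>k - x\<^sub>l)\<close>
(\<open>wasserstein2_empirical_le_energy\<close>).  Cut the circle open, sort the points as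
\<open>y\<^sub>0 \<le> ... \<le> y\<^bsub>n-1\<^esub>\<close>, and send the arc \<open>[i/n + a, (i+1)/n + a)\<close> to \<open>y\<^sub>i\<close>.  The cost of this
monotone plan is an explicit polynomial in the \<open>y\<^sub>i\<close>; for the offset \<open>a\<close> that matches the
barycentres it equals the energy on the right exactly.  The estimate is the
one-dimensional case of the comparison of \<open>W\<^sub>2\<close> with a negative Sobolev norm.\<close>

section \<open>Integration on the torus\<close>

lemma sets_torus_measure [simp, measurable_cong]: "sets torus_measure = sets borel"
  by (simp add: torus_measure_def)

lemma space_torus_measure [simp]: "space torus_measure = UNIV"
  by (simp add: torus_measure_def)

interpretation torus: prob_space torus_measure
  by (rule prob_space_torus_measure)

lemma to_torus_add: "to_torus (s + t) = to_torus s + to_torus t"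
  by (simp add: plus_torus.abs_eq)

lemma to_torus_diff: "to_torus (s - t) = to_torus s - to_torus t"
  by (simp add: minus_torus.abs_eq)

lemma to_torus_one: "to_torus 1 = 0"
  by (simp add: zero_torus_def torus.abs_eq_iff)

lemma torus_representative:
  obtains s where "0 \<le> s" "s < 1" "to_torus s = u"
proof -
  obtain r where r: "u = to_torus r" using Quotient_abs_rep[OF Quotient_torus, of u] by (intro that[of "torus_rep u"]) simp
  have "to_torus (frac r) = u" by (simp add: r torus.abs_eq_iff frac_def)
  then show ?thesis using that[of "frac r"] frac_lt_1[of r] by simp
qed

lemma compact_torus: "compact (UNIV :: torus set)"
proof -
  have "(UNIV :: torus set) = to_torus ` {0..1}"
  proof -
    have "u \<in> to_torus ` {0..1}" for u
      by (rule torus_representative[of u]) auto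
    then show ?thesis by auto
  qed
  then show ?thesis
    by (metis compact_continuous_image continuous_on_to_torus compact_Icc)
qed

lemma dist_torus_add_right: "dist (u + a) (v + a) = dist u (v :: torus)"
  by transfer simp

lemma dist_torus_diff_zero: "dist (u - v) 0 = dist u (v :: torus)"
  by transfer simp

lemma continuous_on_torus_translate: "continuous_on A (\<lambda>u :: torus. u + a)"
  unfolding continuous_on_iff by (auto simp: dist_torus_add_right)

lemma continuous_on_torus_comp:
  fixes f :: "torus \<Rightarrow> 'a :: topological_space"
  assumes "continuous_on UNIV f" "continuous_on UNIV h"
  shows "continuous_on UNIV (\<lambda>u :: torus. f (h u))"
  using continuous_on_compose2[OF assms] by simp

lemma integrable_torus:
  fixes f :: "torus \<Rightarrow> 'a :: {banach, second_countable_topology}"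
  assumes "continuous_on UNIV f"
  shows "integrable torus_measure f"
proof -
  have "bounded (range f)"
    using compact_continuous_image[OF assms compact_torus] by (rule compact_imp_bounded)
  then obtain B where "\<And>u. norm (f u) \<le> B" unfolding bounded_iff by auto
  moreover have "f \<in> borel_measurable torus_measure"
    using borel_measurable_continuous_onI[OF assms] by (simp cong: measurable_cong_sets)
  ultimately show ?thesis
    by (intro torus.integrable_const_bound[where B = B]) auto
qed

lemma nn_integral_torus:
  assumes [measurable]: "g \<in> borel_measurable borel"
  shows "(\<integral>\<^sup>+u. g u \<partial>torus_measure) = (\<integral>\<^sup>+s. g (to_torus s) * indicator {0..<1} s \<partial>lborel)"
proof -
  have m: "to_torus \<in> measurable (restrict_space lborel {0..<1}) borel"
    by (intro measurable_restrict_space1) simp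
  show ?thesis unfolding torus_measure_def
    by (subst nn_integral_distr[OF m]) (auto simp: nn_integral_restrict_space)
qed

lemma integral_torus:
  fixes g :: "torus \<Rightarrow> 'a :: {banach, second_countable_topology}"
  assumes [measurable]: "g \<in> borel_measurable borel"
  shows "(\<integral>u. g u \<partial>torus_measure) = (\<integral>s. indicator {0..<1} s *\<^sub>R g (to_torus s) \<partial>lborel)"
proof -
  have m: "to_torus \<in> measurable (restrict_space lborel {0..<1}) borel"
    by (intro measurable_restrict_space1) simp
  show ?thesis unfolding torus_measure_def
    by (subst integral_distr[OF m]) (auto simp: integral_restrict_space)
qed

text \<open>The window \<open>[a, 1 + a)\<close> covers one period: its part beyond \<open>1\<close>, moved back by \<open>1\<close>, fills the gap
\<open>[0, a)\<close>.\<close>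

lemma nn_integral_periodic_shift:
  fixes G :: "real \<Rightarrow> ennreal"
  assumes [measurable]: "G \<in> borel_measurable borel"
    and per: "\<And>s. G (s + 1) = G s" and a: "0 \<le> a" "a < 1"
  shows "(\<integral>\<^sup>+s. G (s + a) * indicator {0..<1} s \<partial>lborel) = (\<integral>\<^sup>+s. G s * indicator {0..<1} s \<partial>lborel)"
proof -
  have shift: "(\<integral>\<^sup>+s. H (s + b) \<partial>lborel) = (\<integral>\<^sup>+s. H s \<partial>lborel)"
    if "H \<in> borel_measurable borel" for H :: "real \<Rightarrow> ennreal" and b
    using nn_integral_real_affine[OF that, of 1 b] by (simp add: add.commute)
  have "(\<integral>\<^sup>+s. G (s + a) * indicator {0..<1} s \<partial>lborel)
      = (\<integral>\<^sup>+s. (\<lambda>r. G r * indicator {a..<1 + a} r) (s + a) \<partial>lborel)"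
    by (intro nn_integral_cong) (auto simp: indicator_def)
  also have "\<dots> = (\<integral>\<^sup>+r. G r * indicator {a..<1 + a} r \<partial>lborel)"
    by (rule shift) measurable
  also have "\<dots> = (\<integral>\<^sup>+r. G r * indicator {a..<1} r + G r * indicator {1..<1 + a} r \<partial>lborel)"
    using a by (intro nn_integral_cong) (auto simp: indicator_def)
  also have "\<dots> = (\<integral>\<^sup>+r. G r * indicator {a..<1} r \<partial>lborel)
      + (\<integral>\<^sup>+r. G r * indicator {1..<1 + a} r \<partial>lborel)"
    by (rule nn_integral_add) measurable
  also have "(\<integral>\<^sup>+r. G r * indicator {1..<1 + a} r \<partial>lborel)
      = (\<integral>\<^sup>+s. (\<lambda>r. G r * indicator {1..<1 + a} r) (s + 1) \<partial>lborel)"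
    by (rule shift[symmetric]) measurable
  also have "\<dots> = (\<integral>\<^sup>+s. G s * indicator {0..<a} s \<partial>lborel)"
    by (intro nn_integral_cong) (auto simp: indicator_def per add.commute)
  also have "(\<integral>\<^sup>+r. G r * indicator {a..<1} r \<partial>lborel) + (\<integral>\<^sup>+s. G s * indicator {0..<a} s \<partial>lborel)
      = (\<integral>\<^sup>+r. G r * indicator {a..<1} r + G r * indicator {0..<a} r \<partial>lborel)"
    by (rule nn_integral_add[symmetric]) measurable
  also have "\<dots> = (\<integral>\<^sup>+s. G s * indicator {0..<1} s \<partial>lborel)"
    using a by (intro nn_integral_cong) (auto simp: indicator_def)
  finally show ?thesis .
qed

lemma measurable_torus_translate [measurable]:
  "(\<lambda>u. u + a) \<in> borel_measurable (borel :: torus measure)"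
  by (intro borel_measurable_continuous_onI continuous_on_torus_translate)

lemma torus_measure_translate: "distr torus_measure borel (\<lambda>u. u + a) = torus_measure"
proof (rule measure_eqI)
  show "sets (distr torus_measure borel (\<lambda>u. u + a)) = sets torus_measure" by simp
next
  fix A assume "A \<in> sets (distr torus_measure borel (\<lambda>u. u + a))"
  then have [measurable]: "A \<in> sets borel" by simp
  obtain r where r: "0 \<le> r" "r < 1" "to_torus r = a" by (rule torus_representative)
  define G :: "real \<Rightarrow> ennreal" where "G = (\<lambda>s. indicator A (to_torus s))"
  have [measurable]: "G \<in> borel_measurable borel" unfolding G_def by measurable
  have per: "G (s + 1) = G s" for s by (simp add: G_def to_torus_add to_torus_one)
  have "emeasure (distr torus_measure borel (\<lambda>u. u + a)) A
      = (\<integral>\<^sup>+u. indicator A u \<partial>distr torus_measure borel (\<lambda>u. u + a))" by simp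
  also have "\<dots> = (\<integral>\<^sup>+u. indicator A (u + a) \<partial>torus_measure)"
    by (subst nn_integral_distr) auto
  also have "\<dots> = (\<integral>\<^sup>+s. G (s + r) * indicator {0..<1} s \<partial>lborel)"
    by (subst nn_integral_torus) (auto simp: G_def to_torus_add r)
  also have "\<dots> = (\<integral>\<^sup>+s. G s * indicator {0..<1} s \<partial>lborel)"
    using per r by (intro nn_integral_periodic_shift) auto
  also have "\<dots> = (\<integral>\<^sup>+u. indicator A u \<partial>torus_measure)"
    by (subst nn_integral_torus) (auto simp: G_def)
  finally show "emeasure (distr torus_measure borel (\<lambda>u. u + a)) A = emeasure torus_measure A"
    by simp
qed

lemma integral_torus_translate:
  fixes g :: "torus \<Rightarrow> 'a :: {banach, second_countable_topology}"
  assumes "continuous_on UNIV g"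
  shows "(\<integral>u. g (u + a) \<partial>torus_measure) = (\<integral>u. g u \<partial>torus_measure)"
proof -
  have "(\<integral>u. g u \<partial>torus_measure) = (\<integral>u. g u \<partial>distr torus_measure borel (\<lambda>u. u + a))"
    by (simp only: torus_measure_translate)
  also have "\<dots> = (\<integral>u. g (u + a) \<partial>torus_measure)"
    using borel_measurable_continuous_onI[OF assms] by (subst integral_distr) auto
  finally show ?thesis ..
qed

section \<open>Characters\<close>

lemma torus_char_zero [simp]: "torus_char 0 u = 1"
  by transfer simp

lemma torus_char_add: "torus_char (k + l) u = torus_char k u * torus_char l u"
  by transfer (simp add: exp_add[symmetric] algebra_simps)

lemma torus_char_plus: "torus_char k (u + v) = torus_char k u * torus_char k v"
  by transfer (simp add: exp_add[symmetric] algebra_simps)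

lemma torus_char_minus: "torus_char k (- u) = torus_char (- k) u"
  by transfer simp

lemma cnj_torus_char: "cnj (torus_char k u) = torus_char (- k) u"
  by transfer (simp add: exp_cnj)

lemma torus_char_diff: "torus_char k (u - v) = torus_char k u * cnj (torus_char k v)"
  by (metis cnj_torus_char torus_char_minus torus_char_plus diff_conv_add_uminus)

lemma torus_char_diff_index: "torus_char (k - l) u = torus_char k u * cnj (torus_char l u)"
  by (metis cnj_torus_char torus_char_add diff_conv_add_uminus)

lemma norm_torus_char [simp]: "norm (torus_char k u) = 1"
  by transfer (simp add: norm_exp_eq_Re)

lemma torus_char_power: "torus_char (int j) u = torus_char 1 u ^ j"
  by (induction j) (simp_all add: torus_char_add)

lemma torus_char_one_eq_one: "torus_char 1 u = 1 \<longleftrightarrow> u = 0"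
proof transfer
  fix s :: real
  have "exp (2 * of_real pi * \<i> * of_int 1 * complex_of_real s) = 1 \<longleftrightarrow> (\<exists>n::int. s = of_int n)"
    by (auto simp: exp_eq_1)
  then show "exp (2 * of_real pi * \<i> * of_int 1 * complex_of_real s) = 1 \<longleftrightarrow> s - 0 \<in> \<int>"
    by (auto elim: Ints_cases)
qed

text \<open>A character is a homomorphism into the unit circle, so the distance of two of its values
depends only on the difference of the arguments, where \<open>\<bar>e\<^sup>i\<^sup>s - 1\<bar> \<le> \<bar>s\<bar>\<close> applies to the
representative of least modulus.\<close>

lemma torus_char_lipschitz:
  "dist (torus_char k u) (torus_char k v) \<le> 2 * pi * \<bar>of_int k\<bar> * dist u v"
proof -
  have "norm (torus_char k w - 1) \<le> 2 * pi * \<bar>of_int k\<bar> * dist w 0" for w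
  proof -
    obtain s where s: "w = to_torus s" by (metis torus_representative)
    define r where "r = s - of_int (round s)"
    have w: "w = to_torus r" by (simp add: s r_def torus.abs_eq_iff)
    have d: "dist w 0 = \<bar>r\<bar>"
      by (simp add: s dist_torus.abs_eq zero_torus_def dist_to_int_def r_def)
    have "norm (torus_char k w - 1) = norm (exp (\<i> * of_real (2 * pi * of_int k * r)) - 1)"
      by (simp add: w torus_char.abs_eq algebra_simps)
    also have "\<dots> = 2 * \<bar>sin (2 * pi * of_int k * r / 2)\<bar>" by (rule dist_exp_i_1)
    also have "\<dots> \<le> 2 * \<bar>2 * pi * of_int k * r / 2\<bar>"
      by (intro mult_left_mono abs_sin_x_le_abs_x) auto
    finally show ?thesis by (simp add: d abs_mult)
  qed
  from this[of "u - v"] have "norm (torus_char k u * cnj (torus_char k v) - 1)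
      \<le> 2 * pi * \<bar>of_int k\<bar> * dist u v"
    by (simp add: torus_char_diff dist_torus_diff_zero)
  moreover have "torus_char k u - torus_char k v
      = (torus_char k u * cnj (torus_char k v) - 1) * torus_char k v"
  proof -
    have "cnj (torus_char k v) * torus_char k v = 1"
      by (simp add: complex_norm_square[symmetric] mult.commute)
    then show ?thesis by (simp add: algebra_simps)
  qed
  ultimately show ?thesis by (simp add: dist_norm norm_mult)
qed

lemma continuous_on_torus_char: "continuous_on A (torus_char k)"
proof -
  have "(2 * pi * \<bar>of_int k\<bar>)-lipschitz_on A (torus_char k)"
    by (intro lipschitz_onI torus_char_lipschitz) auto
  then show ?thesis by (rule lipschitz_on_continuous_on)
qed

text \<open>For \<open>k \<noteq> 0\<close>, translation by \<open>1/(2k)\<close> preserves the integral and changes the sign of the integrand.\<close>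

lemma integral_torus_char: "(\<integral>u. torus_char k u \<partial>torus_measure) = (if k = 0 then 1 else 0)"
proof (cases "k = 0")
  case True
  then show ?thesis using torus.prob_space by simp
next
  case False
  define a where "a = to_torus (1 / (2 * of_int k))"
  have "2 * of_real pi * \<i> * of_int k * complex_of_real (1 / (2 * of_int k)) = \<i> * of_real pi"
    using False by simp
  then have a: "torus_char k a = - 1"
    unfolding a_def torus_char.abs_eq by (metis exp_pi_i')
  have "(\<integral>u. torus_char k u \<partial>torus_measure) = (\<integral>u. torus_char k (u + a) \<partial>torus_measure)"
    by (rule integral_torus_translate[symmetric]) (rule continuous_on_torus_char)
  also have "\<dots> = - (\<integral>u. torus_char k u \<partial>torus_measure)"
    by (simp add: torus_char_plus a)
  finally show ?thesis using False by simp
qed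

lemma Re_fourier_coeff:
  assumes "continuous_on UNIV f"
  shows "Re (fourier_coeff f k) = (\<integral>u. f u * Re (torus_char k u) \<partial>torus_measure)"
proof -
  have "integrable torus_measure (\<lambda>u. of_real (f u) * torus_char (- k) u)"
    by (intro integrable_torus continuous_intros assms continuous_on_torus_char)
  then have "Re (fourier_coeff f k) = (\<integral>u. Re (of_real (f u) * torus_char (- k) u) \<partial>torus_measure)"
    unfolding fourier_coeff_def by (rule integral_Re[symmetric])
  also have "\<dots> = (\<integral>u. f u * Re (torus_char k u) \<partial>torus_measure)"
    by (simp add: cnj_torus_char[symmetric])
  finally show ?thesis .
qed

lemma integral_Re_torus_char:
  "(\<integral>u. Re (torus_char k u) \<partial>torus_measure) = (if k = 0 then 1 else 0)"
  using integral_Re[OF integrable_torus[OF continuous_on_torus_char[of UNIV k]]]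
  by (simp add: integral_torus_char)

lemma Re_fourier_coeff_diff_const:
  assumes f: "continuous_on UNIV f"
  shows "Re (fourier_coeff (\<lambda>u. f u - a) k) = Re (fourier_coeff f k) - (if k = 0 then a else 0)"
proof -
  have "Re (fourier_coeff (\<lambda>u. f u - a) k)
      = (\<integral>u. f u * Re (torus_char k u) - a * Re (torus_char k u) \<partial>torus_measure)"
    by (subst Re_fourier_coeff) (auto intro!: continuous_intros f simp: algebra_simps)
  also have "\<dots> = (\<integral>u. f u * Re (torus_char k u) \<partial>torus_measure) - (\<integral>u. a * Re (torus_char k u) \<partial>torus_measure)"
    by (intro Bochner_Integration.integral_diff integrable_torus continuous_intros f continuous_on_torus_char)
  finally show ?thesis by (simp add: Re_fourier_coeff[OF f] integral_Re_torus_char)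
qed

lemma Re_fourier_coeff_diff_cmult:
  assumes f: "continuous_on UNIV f" and g: "continuous_on UNIV g"
  shows "Re (fourier_coeff (\<lambda>u. f u - a * g u) k) = Re (fourier_coeff f k) - a * Re (fourier_coeff g k)"
proof -
  have "Re (fourier_coeff (\<lambda>u. f u - a * g u) k)
      = (\<integral>u. f u * Re (torus_char k u) - a * (g u * Re (torus_char k u)) \<partial>torus_measure)"
    by (subst Re_fourier_coeff) (auto intro!: continuous_intros f g simp: algebra_simps)
  also have "\<dots> = (\<integral>u. f u * Re (torus_char k u) \<partial>torus_measure) - (\<integral>u. a * (g u * Re (torus_char k u)) \<partial>torus_measure)"
    by (intro Bochner_Integration.integral_diff integrable_torus continuous_intros f g continuous_on_torus_char)
  finally show ?thesis by (simp add: Re_fourier_coeff[OF f] Re_fourier_coeff[OF g])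
qed

section \<open>Fejer means and positive definiteness\<close>

definition fejer_kernel :: "nat \<Rightarrow> torus \<Rightarrow> real" where
  "fejer_kernel N u = (norm (\<Sum>j<N. torus_char (int j) u))\<^sup>2 / real N"

lemma fejer_kernel_nonneg: "0 \<le> fejer_kernel N u"
  by (simp add: fejer_kernel_def)

lemma continuous_on_fejer_kernel: "continuous_on A (fejer_kernel N)"
  unfolding fejer_kernel_def by (cases "N = 0") (auto intro!: continuous_intros continuous_on_torus_char)

lemma fejer_kernel_expand:
  "complex_of_real (fejer_kernel N u) = (\<Sum>j<N. \<Sum>l<N. torus_char (int j - int l) u) / of_nat N"
proof -
  have "complex_of_real (fejer_kernel N u)
      = (\<Sum>j<N. torus_char (int j) u) * cnj (\<Sum>l<N. torus_char (int l) u) / of_nat N"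
    by (simp add: fejer_kernel_def complex_norm_square del: of_real_power)
  also have "(\<Sum>j<N. torus_char (int j) u) * cnj (\<Sum>l<N. torus_char (int l) u)
      = (\<Sum>j<N. \<Sum>l<N. torus_char (int j - int l) u)"
    by (simp add: sum_product torus_char_diff_index)
  finally show ?thesis .
qed

lemma integral_fejer_kernel:
  assumes "N > 0"
  shows "(\<integral>u. fejer_kernel N u \<partial>torus_measure) = 1"
proof -
  have "complex_of_real (\<integral>u. fejer_kernel N u \<partial>torus_measure)
      = (\<integral>u. (\<Sum>j<N. \<Sum>l<N. torus_char (int j - int l) u) / of_nat N \<partial>torus_measure)"
    by (simp only: integral_complex_of_real[symmetric] fejer_kernel_expand)
  also have "\<dots> = (\<Sum>j<N. \<Sum>l<N. (if j = l then 1 else 0)) / of_nat N"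
    by (simp add: integrable_torus continuous_on_torus_char integral_torus_char
        Bochner_Integration.integral_sum)
  also have "\<dots> = 1" using assms by simp
  finally show ?thesis by (simp only: of_real_eq_1_iff)
qed

text \<open>Multiplying by \<open>z - 1\<close> sums the geometric progression to \<open>z\<^sup>N - 1\<close>.  This makes the kernel small
away from \<open>0\<close> in a form that can be integrated against a quadratic weight.\<close>

lemma fejer_kernel_tail: "(norm (torus_char 1 u - 1))\<^sup>2 * fejer_kernel N u \<le> 4 / real N"
proof -
  let ?z = "torus_char 1 u"
  have "(?z - 1) * (\<Sum>j<N. torus_char (int j) u) = ?z ^ N - 1"
    by (simp add: torus_char_power power_diff_1_eq)
  then have "norm (?z - 1) * norm (\<Sum>j<N. torus_char (int j) u) = norm (?z ^ N - 1)"
    by (metis norm_mult)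
  also have "\<dots> \<le> norm (?z ^ N) + norm (1 :: complex)" by (rule norm_triangle_ineq4)
  also have "\<dots> = 2" by (simp add: norm_power)
  finally have "(norm (?z - 1) * norm (\<Sum>j<N. torus_char (int j) u))\<^sup>2 \<le> 2\<^sup>2"
    by (intro power_mono) auto
  then have "(norm (?z - 1) * norm (\<Sum>j<N. torus_char (int j) u))\<^sup>2 / real N \<le> 4 / real N"
    by (intro divide_right_mono) auto
  then show ?thesis by (simp add: fejer_kernel_def power_mult_distrib)
qed

text \<open>Near \<open>t\<close> the oscillation of \<open>f\<close> is below \<open>\<epsilon>\<close>; on the compact remainder the weight
\<open>\<bar>e(u - t) - 1\<bar>\<^sup>2\<close> has no zero, so a multiple of it dominates.  The weight is chosen to cancel
against the Fejer kernel (\<open>fejer_kernel_tail\<close>).\<close>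

lemma continuous_quadratic_modulus:
  fixes f :: "torus \<Rightarrow> real"
  assumes f: "continuous_on UNIV f" and "\<epsilon> > 0"
  obtains K where "K \<ge> 0" "\<And>u. \<bar>f u - f t\<bar> \<le> \<epsilon> + K * (norm (torus_char 1 (u - t) - 1))\<^sup>2"
proof -
  define h where "h = (\<lambda>u. (norm (torus_char 1 (u - t) - 1))\<^sup>2)"
  have cont_shift: "continuous_on UNIV (\<lambda>u. torus_char 1 (u + - t))"
    by (intro continuous_on_torus_comp[OF continuous_on_torus_char] continuous_on_torus_translate)
  then have h_cont: "continuous_on UNIV h"
    unfolding h_def by (auto intro!: continuous_intros)
  have h_pos: "h u > 0" if "u \<noteq> t" for u
    using that by (simp add: h_def torus_char_one_eq_one)
  obtain \<delta> where \<delta>: "\<delta> > 0" "\<And>u. dist u t < \<delta> \<Longrightarrow> \<bar>f u - f t\<bar> < \<epsilon>"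
    using f \<open>\<epsilon> > 0\<close> unfolding continuous_on_iff dist_real_def by (metis UNIV_I)
  define S where "S = {u. \<delta> \<le> dist u t}"
  have "closed S" unfolding S_def by (intro closed_Collect_le continuous_intros)
  then have S: "compact S" using compact_Int_closed[OF compact_torus] by auto
  have cont: "continuous_on S (\<lambda>u. \<bar>f u - f t\<bar> / h u)"
  proof (intro continuous_intros continuous_on_subset[OF f] continuous_on_subset[OF h_cont])
    show "\<forall>u\<in>S. h u \<noteq> 0"
    proof
      fix u assume "u \<in> S"
      then have "u \<noteq> t" using \<delta>(1) by (auto simp: S_def)
      then show "h u \<noteq> 0" using h_pos[of u] by simp
    qed
  qed auto
  then have "bounded ((\<lambda>u. \<bar>f u - f t\<bar> / h u) ` S)"
    using compact_continuous_image[OF cont S] by (intro compact_imp_bounded)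
  then obtain K where K: "K > 0" "\<And>u. u \<in> S \<Longrightarrow> \<bar>\<bar>f u - f t\<bar> / h u\<bar> \<le> K"
    unfolding bounded_pos by auto
  show thesis
  proof
    show "K \<ge> 0" using K by simp
    fix u
    show "\<bar>f u - f t\<bar> \<le> \<epsilon> + K * (norm (torus_char 1 (u - t) - 1))\<^sup>2"
    proof (cases "u \<in> S")
      case True
      then have "h u > 0" using \<delta>(1) by (intro h_pos) (auto simp: S_def)
      moreover have "\<bar>f u - f t\<bar> / h u \<le> K" using K(2)[OF True] by linarith
      ultimately have "\<bar>f u - f t\<bar> \<le> K * h u" by (simp add: divide_simps)
      then show ?thesis using \<open>\<epsilon> > 0\<close> by (simp add: h_def)
    next
      case False
      then have "\<bar>f u - f t\<bar> < \<epsilon>" using \<delta>(2) by (simp add: S_def)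
      moreover have "0 \<le> K * (norm (torus_char 1 (u - t) - 1))\<^sup>2" using K by simp
      ultimately show ?thesis by linarith
    qed
  qed
qed

text \<open>The kernel has mass \<open>1\<close>, so the error is at most the integral of the oscillation of \<open>f\<close> against
it, which \<open>continuous_quadratic_modulus\<close> and \<open>fejer_kernel_tail\<close> bound by \<open>\<epsilon> + 4K/N\<close>.\<close>

lemma fejer_means_tendsto:
  fixes f :: "torus \<Rightarrow> real"
  assumes f: "continuous_on UNIV f"
  shows "(\<lambda>N. \<integral>u. f u * fejer_kernel N (u - t) \<partial>torus_measure) \<longlonglongrightarrow> f t"
proof (rule LIMSEQ_I)
  fix \<epsilon> :: real assume "\<epsilon> > 0"
  then obtain K where K: "K \<ge> 0"
    "\<And>u. \<bar>f u - f t\<bar> \<le> \<epsilon> / 2 + K * (norm (torus_char 1 (u - t) - 1))\<^sup>2"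
    using continuous_quadratic_modulus[OF f, of "\<epsilon> / 2" t] by auto
  have Fcont: "continuous_on UNIV (\<lambda>u. fejer_kernel N (u - t))" for N
    using continuous_on_torus_comp[OF continuous_on_fejer_kernel continuous_on_torus_translate, of N "- t"]
    by simp
  have F1: "(\<integral>u. fejer_kernel N (u - t) \<partial>torus_measure) = 1" if "N > 0" for N
    using integral_torus_translate[OF continuous_on_fejer_kernel, of N "- t"] integral_fejer_kernel[OF that]
    by simp
  have bound: "\<bar>(\<integral>u. f u * fejer_kernel N (u - t) \<partial>torus_measure) - f t\<bar> \<le> \<epsilon> / 2 + K * 4 / real N"
    if N: "N > 0" for N
  proof -
    have "(\<integral>u. f u * fejer_kernel N (u - t) \<partial>torus_measure) - f t
        = (\<integral>u. f u * fejer_kernel N (u - t) \<partial>torus_measure)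
          - (\<integral>u. f t * fejer_kernel N (u - t) \<partial>torus_measure)"
      by (simp add: F1[OF N])
    also have "\<dots> = (\<integral>u. (f u - f t) * fejer_kernel N (u - t) \<partial>torus_measure)"
      by (subst Bochner_Integration.integral_diff[symmetric])
        (auto intro!: integrable_torus continuous_intros f Fcont simp: algebra_simps)
    finally have "\<bar>(\<integral>u. f u * fejer_kernel N (u - t) \<partial>torus_measure) - f t\<bar>
        \<le> (\<integral>u. \<bar>(f u - f t) * fejer_kernel N (u - t)\<bar> \<partial>torus_measure)"
      using integral_abs_bound by metis
    also have "\<dots> \<le> (\<integral>u. \<epsilon> / 2 * fejer_kernel N (u - t) + K * 4 / real N \<partial>torus_measure)"
    proof (rule integral_mono)
      fix u
      have "\<bar>(f u - f t) * fejer_kernel N (u - t)\<bar>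
          \<le> (\<epsilon> / 2 + K * (norm (torus_char 1 (u - t) - 1))\<^sup>2) * fejer_kernel N (u - t)"
        using K(2) by (simp add: abs_mult fejer_kernel_nonneg mult_right_mono)
      also have "\<dots> = \<epsilon> / 2 * fejer_kernel N (u - t)
          + K * ((norm (torus_char 1 (u - t) - 1))\<^sup>2 * fejer_kernel N (u - t))"
        by (simp add: algebra_simps)
      also have "\<dots> \<le> \<epsilon> / 2 * fejer_kernel N (u - t) + K * (4 / real N)"
        using K(1) fejer_kernel_tail by (intro add_left_mono mult_left_mono) auto
      finally show "\<bar>(f u - f t) * fejer_kernel N (u - t)\<bar>
          \<le> \<epsilon> / 2 * fejer_kernel N (u - t) + K * 4 / real N" by simp
    qed (auto intro!: integrable_torus continuous_intros f Fcont)
    also have "\<dots> = \<epsilon> / 2 + K * 4 / real N"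
      using torus.prob_space by (simp add: F1[OF N] integrable_torus Fcont)
    finally show ?thesis .
  qed
  obtain N0 :: nat where N0: "K * 8 / \<epsilon> < real N0" using reals_Archimedean2 by blast
  have "norm ((\<integral>u. f u * fejer_kernel N (u - t) \<partial>torus_measure) - f t) < \<epsilon>" if "N \<ge> Suc N0" for N
  proof -
    have "K * 8 / \<epsilon> < real N" using N0 that by simp
    then have "K * 4 / real N < \<epsilon> / 2" using \<open>\<epsilon> > 0\<close> that by (simp add: field_simps)
    then show ?thesis using bound[of N] that by simp
  qed
  then show "\<exists>N0. \<forall>N\<ge>N0. norm ((\<integral>u. f u * fejer_kernel N (u - t) \<partial>torus_measure) - f t) < \<epsilon>" by blast
qed

lemma fejer_means_fourier:
  assumes f: "continuous_on UNIV f"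
  shows "complex_of_real (\<integral>u. f u * fejer_kernel N (u - t) \<partial>torus_measure)
    = (\<Sum>j<N. \<Sum>l<N. fourier_coeff f (int l - int j) * torus_char (int l - int j) t) / of_nat N"
proof -
  have int: "integrable torus_measure (\<lambda>u. of_real (f u) * torus_char k u)" for k
    by (intro integrable_torus continuous_intros f continuous_on_torus_char)
  have ch: "torus_char (int j - int l) (u - t) = torus_char (int l - int j) t * torus_char (- (int l - int j)) u" for j l u
    by (simp add: torus_char_diff cnj_torus_char mult.commute)
  have "complex_of_real (\<integral>u. f u * fejer_kernel N (u - t) \<partial>torus_measure)
      = (\<integral>u. of_real (f u) * ((\<Sum>j<N. \<Sum>l<N. torus_char (int j - int l) (u - t)) / of_nat N) \<partial>torus_measure)"
    by (simp only: integral_complex_of_real[symmetric] fejer_kernel_expand[symmetric] of_real_mult)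
  also have "\<dots> = (\<integral>u. (\<Sum>j<N. \<Sum>l<N. torus_char (int l - int j) t
      * (of_real (f u) * torus_char (- (int l - int j)) u)) / of_nat N \<partial>torus_measure)"
    by (simp only: ch sum_distrib_left times_divide_eq_right mult.left_commute)
  also have "\<dots> = (\<Sum>j<N. \<Sum>l<N. torus_char (int l - int j) t * fourier_coeff f (int l - int j)) / of_nat N"
    unfolding fourier_coeff_def
    by (simp add: int integrable_sum Bochner_Integration.integral_sum)
  finally show ?thesis by (simp add: mult.commute)
qed

text \<open>For a single character the quadratic form is the square \<open>\<bar>\<Sum>a. w\<^sub>a e(k x\<^sub>a)\<bar>\<^sup>2\<close>, so the form of a Fejer
mean is a combination of squares.  The form is real, so only the real parts of the coefficients
count, and these are nonnegative.  Convergence of the Fejer means at the finitely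
many differences \<open>x\<^sub>a - x\<^sub>b\<close> carries the sign over to \<open>f\<close>.\<close>

lemma nonneg_fourier_imp_positive_definite:
  fixes w :: "'i \<Rightarrow> real"
  assumes f: "continuous_on UNIV f" and nonneg: "\<And>k. Re (fourier_coeff f k) \<ge> 0"
  shows "0 \<le> (\<Sum>a\<in>I. \<Sum>b\<in>I. w a * w b * f (x a - x b))"
proof (rule LIMSEQ_le_const)
  let ?m = "\<lambda>N t. \<integral>u. f u * fejer_kernel N (u - t) \<partial>torus_measure"
  show "(\<lambda>N. \<Sum>a\<in>I. \<Sum>b\<in>I. w a * w b * ?m N (x a - x b))
      \<longlonglongrightarrow> (\<Sum>a\<in>I. \<Sum>b\<in>I. w a * w b * f (x a - x b))"
    by (intro tendsto_intros fejer_means_tendsto f)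
  have "0 \<le> (\<Sum>a\<in>I. \<Sum>b\<in>I. w a * w b * ?m N (x a - x b))" for N
  proof -
    define S where "S k = (\<Sum>a\<in>I. of_real (w a) * torus_char k (x a))" for k
    have S: "(\<Sum>a\<in>I. \<Sum>b\<in>I. of_real (w a * w b) * torus_char k (x a - x b)) = of_real ((norm (S k))\<^sup>2)" for k
      unfolding complex_norm_square S_def
      by (simp add: sum_product torus_char_diff mult_ac)
    have "complex_of_real (\<Sum>a\<in>I. \<Sum>b\<in>I. w a * w b * ?m N (x a - x b))
        = (\<Sum>a\<in>I. \<Sum>b\<in>I. of_real (w a * w b) * ((\<Sum>j<N. \<Sum>l<N.
            fourier_coeff f (int l - int j) * torus_char (int l - int j) (x a - x b)) / of_nat N))"
      by (simp only: of_real_sum of_real_mult fejer_means_fourier[OF f])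
    also have "\<dots> = (\<Sum>a\<in>I. \<Sum>b\<in>I. \<Sum>j<N. \<Sum>l<N. fourier_coeff f (int l - int j) *
            (of_real (w a * w b) * torus_char (int l - int j) (x a - x b))) / of_nat N"
      by (simp only: sum_distrib_left sum_divide_distrib times_divide_eq_right mult.left_commute)
    also have "(\<Sum>a\<in>I. \<Sum>b\<in>I. \<Sum>j<N. \<Sum>l<N. fourier_coeff f (int l - int j) *
            (of_real (w a * w b) * torus_char (int l - int j) (x a - x b)))
        = (\<Sum>j<N. \<Sum>l<N. \<Sum>a\<in>I. \<Sum>b\<in>I. fourier_coeff f (int l - int j) *
            (of_real (w a * w b) * torus_char (int l - int j) (x a - x b)))"
      by (simp only: sum.swap[of _ "{..<N}" I])
    also have "\<dots> = (\<Sum>j<N. \<Sum>l<N. fourier_coeff f (int l - int j) * of_real ((norm (S (int l - int j)))\<^sup>2))"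
      by (simp only: sum_distrib_left[symmetric] S)
    finally have "Re (complex_of_real (\<Sum>a\<in>I. \<Sum>b\<in>I. w a * w b * ?m N (x a - x b)))
        = Re ((\<Sum>j<N. \<Sum>l<N. fourier_coeff f (int l - int j) * of_real ((norm (S (int l - int j)))\<^sup>2)) / of_nat N)"
      by (rule arg_cong)
    also have "\<dots> = (\<Sum>j<N. \<Sum>l<N. Re (fourier_coeff f (int l - int j)) * (norm (S (int l - int j)))\<^sup>2) / real N"
      by (simp add: Re_divide_of_nat del: of_real_power)
    finally have "(\<Sum>a\<in>I. \<Sum>b\<in>I. w a * w b * ?m N (x a - x b))
        = (\<Sum>j<N. \<Sum>l<N. Re (fourier_coeff f (int l - int j)) * (norm (S (int l - int j)))\<^sup>2) / real N"
      by (simp only: Re_complex_of_real)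
    also have "\<dots> \<ge> 0"
      by (intro divide_nonneg_nonneg sum_nonneg mult_nonneg_nonneg nonneg) auto
    finally show ?thesis .
  qed
  then show "\<exists>N0. \<forall>N\<ge>N0. 0 \<le> (\<Sum>a\<in>I. \<Sum>b\<in>I. w a * w b * ?m N (x a - x b))" by blast
qed

section \<open>The periodic Bernoulli polynomial\<close>

text \<open>The second Bernoulli polynomial \<open>s\<^sup>2 - s + 1/6\<close> is invariant under \<open>s \<mapsto> 1 - s\<close>, so its value at
the fractional part is also its value at the distance to \<open>0\<close>.  Writing it through the distance makes
evenness and continuity on the torus evident.\<close>

definition periodic_bernoulli :: "torus \<Rightarrow> real" where
  "periodic_bernoulli u = (dist u 0)\<^sup>2 - dist u 0 + 1 / 6"

lemma continuous_on_periodic_bernoulli: "continuous_on A periodic_bernoulli"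
  unfolding periodic_bernoulli_def by (intro continuous_intros)

lemma periodic_bernoulli_to_torus:
  assumes "\<bar>s\<bar> \<le> 1"
  shows "periodic_bernoulli (to_torus s) = s\<^sup>2 - \<bar>s\<bar> + 1 / 6"
proof -
  have d: "dist (to_torus s) 0 = \<bar>s - of_int (round s)\<bar>"
    by (simp add: zero_torus_def dist_torus.abs_eq dist_to_int_def)
  have r: "\<bar>of_int (round s) - s\<bar> \<le> 1 / 2" by (rule of_int_round_abs_le)
  then have "round s \<le> 1" "- 1 \<le> round s" using assms by linarith+
  then consider "round s = 0" | "round s = 1" | "round s = - 1" by linarith
  then show ?thesis
  proof cases
    case 1
    then show ?thesis by (simp add: periodic_bernoulli_def d)
  next
    case 2
    then have d': "dist (to_torus s) 0 = 1 - s" and "s \<ge> 0" using r assms d by auto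
    then show ?thesis unfolding periodic_bernoulli_def d' by (simp add: power2_eq_square algebra_simps)
  next
    case 3
    then have d': "dist (to_torus s) 0 = 1 + s" and "s \<le> 0" using r assms d by auto
    then show ?thesis unfolding periodic_bernoulli_def d' by (simp add: power2_eq_square algebra_simps)
  qed
qed

lemma Re_fourier_coeff_periodic_bernoulli:
  "Re (fourier_coeff periodic_bernoulli k) = (if k = 0 then 0 else 1 / (2 * pi\<^sup>2 * (of_int k)\<^sup>2))"
proof -
  define \<omega> :: real where "\<omega> = 2 * pi * of_int k"
  let ?p = "\<lambda>s :: real. s\<^sup>2 - s + 1 / 6"
  have "Re (fourier_coeff periodic_bernoulli k)
      = (\<integral>s. indicator {0..<1} s *\<^sub>R (periodic_bernoulli (to_torus s) * Re (torus_char k (to_torus s))) \<partial>lborel)"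
    unfolding Re_fourier_coeff[OF continuous_on_periodic_bernoulli]
    by (intro integral_torus borel_measurable_continuous_onI continuous_intros
        continuous_on_periodic_bernoulli continuous_on_torus_char)
  also have "\<dots> = (\<integral>s. (?p s * cos (\<omega> * s)) * indicator {0..1} s \<partial>lborel)"
  proof (rule integral_cong_AE)
    have [measurable]: "periodic_bernoulli \<in> borel_measurable borel" "torus_char k \<in> borel_measurable borel"
      by (auto intro!: borel_measurable_continuous_onI continuous_on_periodic_bernoulli continuous_on_torus_char)
    show "(\<lambda>s. indicator {0..<1} s *\<^sub>R (periodic_bernoulli (to_torus s) * Re (torus_char k (to_torus s))))
        \<in> borel_measurable lborel" by measurable
    show "AE s in lborel. indicator {0..<1} s *\<^sub>R (periodic_bernoulli (to_torus s) * Re (torus_char k (to_torus s)))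
        = (?p s * cos (\<omega> * s)) * indicator {0..1} s"
      using AE_lborel_singleton[of 1]
      by eventually_elim
        (auto simp: indicator_def periodic_bernoulli_to_torus torus_char.abs_eq Re_exp \<omega>_def)
  qed measurable
  also have "\<dots> = (if k = 0 then 0 else 1 / (2 * pi\<^sup>2 * (of_int k)\<^sup>2))"
  proof (cases "k = 0")
    case True
    have "(\<integral>s. ?p s * indicator {0..1} s \<partial>lborel)
        = (1 ^ 3 / 3 - 1\<^sup>2 / 2 + 1 / 6 :: real) - (0 ^ 3 / 3 - 0\<^sup>2 / 2 + 0 / 6)"
      by (intro integral_FTC_Icc_real) (auto intro!: derivative_eq_intros simp: power2_eq_square)
    then show ?thesis using True by (simp add: \<omega>_def)
  next
    case False
    then have \<omega>: "\<omega> \<noteq> 0" by (simp add: \<omega>_def)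
    \<comment> \<open>The antiderivative \<open>F\<close> comes from integrating by parts until the quadratic is used up;
      only the boundary term with \<open>1/\<omega>\<^sup>2\<close> survives.\<close>
    define r where "r = 1 / \<omega>"
    have r: "r * \<omega> = 1" using \<omega> by (simp add: r_def)
    define F where "F s = ?p s * sin (\<omega> * s) * r + (2 * s - 1) * cos (\<omega> * s) * r\<^sup>2
        - 2 * sin (\<omega> * s) * r ^ 3" for s
    have "(\<integral>s. (?p s * cos (\<omega> * s)) * indicator {0..1} s \<partial>lborel) = F 1 - F 0"
    proof (rule integral_FTC_Icc_real)
      fix s
      have "DERIV F s :> ((2 * s - 1) * sin (\<omega> * s) + ?p s * (cos (\<omega> * s) * \<omega>)) * r
          + (2 * cos (\<omega> * s) - (2 * s - 1) * (sin (\<omega> * s) * \<omega>)) * r\<^sup>2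
          - 2 * (cos (\<omega> * s) * \<omega>) * r ^ 3" (is "DERIV F s :> ?D")
        unfolding F_def by (auto intro!: derivative_eq_intros simp: algebra_simps)
      also have "?D = ?p s * cos (\<omega> * s)" using r by algebra
      finally show "DERIV F s :> ?p s * cos (\<omega> * s)" .
    qed auto
    also have "\<dots> = 2 / \<omega>\<^sup>2"
      by (simp add: F_def r_def \<omega>_def sin_int_2pin cos_int_2pin power_divide)
    also have "\<dots> = 1 / (2 * pi\<^sup>2 * (of_int k)\<^sup>2)"
      by (simp add: \<omega>_def power_mult_distrib)
    finally show ?thesis using False by simp
  qed
  finally show ?thesis .
qed

section \<open>Transport of Lebesgue measure to finitely many points\<close>

text \<open>In increasing order, \<open>z\<^sub>i\<close> exceeds \<open>i\<close> of the other values and is exceeded by \<open>n - 1 - i\<close> of them.\<close>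

lemma sum_abs_diff_mono:
  fixes z :: "nat \<Rightarrow> real"
  assumes "mono_on {..<n} z"
  shows "(\<Sum>i<n. \<Sum>j<n. \<bar>z i - z j\<bar>) = 2 * (\<Sum>i<n. (2 * real i + 1 - real n) * z i)"
  using assms
proof (induction n)
  case (Suc n)
  have le: "z i \<le> z n" if "i < n" for i
    using Suc.prems that by (auto simp: mono_on_def)
  have IH: "(\<Sum>i<n. \<Sum>j<n. \<bar>z i - z j\<bar>) = 2 * (\<Sum>i<n. (2 * real i + 1 - real n) * z i)"
    by (rule Suc.IH) (rule mono_on_subset[OF Suc.prems], auto)
  have 1: "(\<Sum>i<n. \<bar>z i - z n\<bar>) = real n * z n - (\<Sum>i<n. z i)"
    using le by (simp add: sum_subtractf)
  have 2: "(\<Sum>i<n. \<bar>z n - z i\<bar>) = real n * z n - (\<Sum>i<n. z i)"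
    using le by (simp add: sum_subtractf)
  have "(\<Sum>i<Suc n. \<Sum>j<Suc n. \<bar>z i - z j\<bar>)
      = (\<Sum>i<n. \<Sum>j<n. \<bar>z i - z j\<bar>) + 2 * (real n * z n - (\<Sum>i<n. z i))"
    by (simp add: sum.distrib 1 2)
  moreover have "(\<Sum>i<n. (2 * real i + 1 - real (Suc n)) * z i)
      = (\<Sum>i<n. (2 * real i + 1 - real n) * z i) - (\<Sum>i<n. z i)"
    by (simp add: sum_subtractf[symmetric] algebra_simps)
  ultimately show ?case
    by (simp add: IH algebra_simps)
qed simp

text \<open>The identity behind the transport estimate.  The \<open>i\<close>-th summand on the left is the integral of
\<open>(s - 1/2 - z\<^sub>i)\<^sup>2\<close> over \<open>[i/n, (i+1)/n]\<close>, so the left side is the cost of moving the uniform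
distribution on \<open>[-1/2, 1/2]\<close> monotonically onto the \<open>z\<^sub>i\<close>.  When expanded, it is \<open>1/12\<close>, minus a
multiple of \<open>\<Sum>i. (2i + 1 - n) z\<^sub>i\<close>, plus the variance.  The middle term is half of
\<open>\<Sum>i,j. \<bar>z\<^sub>i - z\<^sub>j\<bar>\<close> by \<open>sum_abs_diff_mono\<close>, and the variance is half of the mean of \<open>(z\<^sub>i - z\<^sub>j)\<^sup>2\<close>
because the \<open>z\<^sub>i\<close> are centred.\<close>

lemma staircase_cost_eq_energy:
  fixes z :: "nat \<Rightarrow> real"
  assumes mono: "mono_on {..<n} z" and centred: "(\<Sum>i<n. z i) = 0" and n: "n > 0"
  shows "(\<Sum>i<n. ((real (Suc i) / n - 1 / 2 - z i) ^ 3 - (real i / n - 1 / 2 - z i) ^ 3) / 3)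
    = (\<Sum>i<n. \<Sum>j<n. (z i - z j)\<^sup>2 - \<bar>z i - z j\<bar> + 1 / 6) / (2 * (real n)\<^sup>2)"
proof -
  define p where "p i = real i / n - 1 / 2" for i
  have step: "p (Suc i) = p i + 1 / n" for i by (simp add: p_def add_divide_distrib)
  have "(\<Sum>i<n. ((p (Suc i) - z i) ^ 3 - (p i - z i) ^ 3) / 3)
      = (\<Sum>i<n. ((p (Suc i)) ^ 3 - (p i) ^ 3) / 3 - (2 * real i + 1 - real n) * z i / (real n)\<^sup>2 + (z i)\<^sup>2 / n)"
  proof (rule sum.cong[OF refl])
    fix i
    have "((p (Suc i) - z i) ^ 3 - (p i - z i) ^ 3) / 3
        = ((p (Suc i)) ^ 3 - (p i) ^ 3) / 3 - z i * ((p (Suc i))\<^sup>2 - (p i)\<^sup>2) + (z i)\<^sup>2 * (p (Suc i) - p i)"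
      by (simp add: power2_eq_square power3_eq_cube field_simps)
    moreover have "(p (Suc i))\<^sup>2 - (p i)\<^sup>2 = (2 * real i + 1 - real n) / (real n)\<^sup>2"
      using n by (simp add: p_def power2_eq_square field_simps)
    moreover have "p (Suc i) - p i = 1 / n" by (simp add: step)
    ultimately show "((p (Suc i) - z i) ^ 3 - (p i - z i) ^ 3) / 3
        = ((p (Suc i)) ^ 3 - (p i) ^ 3) / 3 - (2 * real i + 1 - real n) * z i / (real n)\<^sup>2 + (z i)\<^sup>2 / n"
      by (simp add: mult.commute)
  qed
  also have "\<dots> = (\<Sum>i<n. (p (Suc i)) ^ 3 - (p i) ^ 3) / 3
      - (\<Sum>i<n. (2 * real i + 1 - real n) * z i) / (real n)\<^sup>2 + (\<Sum>i<n. (z i)\<^sup>2) / n"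
    by (simp only: sum.distrib sum_subtractf sum_divide_distrib[symmetric])
  also have "(\<Sum>i<n. (p (Suc i)) ^ 3 - (p i) ^ 3) = (p n) ^ 3 - (p 0) ^ 3"
    by (rule sum_lessThan_telescope)
  also have "\<dots> = 1 / 4" using n by (simp add: p_def power3_eq_cube)
  finally have cost: "(\<Sum>i<n. ((p (Suc i) - z i) ^ 3 - (p i - z i) ^ 3) / 3)
      = 1 / 12 - (\<Sum>i<n. (2 * real i + 1 - real n) * z i) / (real n)\<^sup>2 + (\<Sum>i<n. (z i)\<^sup>2) / n"
    by simp
  have cross: "(\<Sum>i<n. \<Sum>j<n. 2 * (z i * z j)) = 2 * ((\<Sum>i<n. z i) * (\<Sum>j<n. z j))"
    by (subst sum_product) (simp only: sum_distrib_left)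
  have "(\<Sum>i<n. \<Sum>j<n. (z i - z j)\<^sup>2)
      = (\<Sum>i<n. \<Sum>j<n. (z i)\<^sup>2) - 2 * ((\<Sum>i<n. z i) * (\<Sum>j<n. z j)) + (\<Sum>i<n. \<Sum>j<n. (z j)\<^sup>2)"
    by (simp only: cross[symmetric] power2_diff sum.distrib sum_subtractf mult.assoc)
  also have "\<dots> = 2 * real n * (\<Sum>i<n. (z i)\<^sup>2)"
    by (simp add: centred sum_distrib_left[symmetric])
  finally have "(\<Sum>i<n. \<Sum>j<n. (z i - z j)\<^sup>2 - \<bar>z i - z j\<bar> + 1 / 6)
      = 2 * real n * (\<Sum>i<n. (z i)\<^sup>2) - 2 * (\<Sum>i<n. (2 * real i + 1 - real n) * z i) + (real n)\<^sup>2 / 6"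
    by (simp add: sum.distrib sum_subtractf sum_abs_diff_mono[OF mono] power2_eq_square)
  then show ?thesis
    using cost n by (simp add: p_def field_simps power2_eq_square)
qed

text \<open>Sums over a family depend only on its multiset of values; this lets the points be sorted without
an explicit permutation.\<close>

lemma sum_image_mset_eq:
  assumes "image_mset y (mset_set A) = image_mset r (mset_set B)"
  shows "(\<Sum>i\<in>A. g (y i)) = (\<Sum>k\<in>B. g (r k))"
proof -
  have "(\<Sum>i\<in>A. g (y i)) = sum_mset (image_mset g (image_mset y (mset_set A)))"
    by (simp add: sum_unfold_sum_mset multiset.map_comp comp_def)
  also have "\<dots> = (\<Sum>k\<in>B. g (r k))"
    by (simp add: assms sum_unfold_sum_mset multiset.map_comp comp_def)
  finally show ?thesis .
qed

lemma sorted_enumeration: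
  fixes r :: "nat \<Rightarrow> 'a :: linorder"
  obtains y where "mono_on {..<n} y" "image_mset y (mset_set {..<n}) = image_mset r (mset_set {1..n})"
proof
  define l where "l = sort (map r [1..<Suc n])"
  have len: "length l = n" by (simp add: l_def)
  show "mono_on {..<n} ((!) l)"
    by (auto simp: mono_on_def len intro!: sorted_nth_mono) (simp add: l_def)
  have "image_mset ((!) l) (mset_set {..<n}) = mset (map ((!) l) [0..<length l])"
    by (simp add: len lessThan_atLeast0 del: map_nth)
  also have "\<dots> = mset l" by (simp only: map_nth)
  also have "\<dots> = image_mset r (mset_set {1..n})"
    by (simp add: l_def atLeastLessThanSuc_atLeastAtMost del: upt_Suc)
  finally show "image_mset ((!) l) (mset_set {..<n}) = image_mset r (mset_set {1..n})" .
qed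

text \<open>The index \<open>\<lfloor>n s\<rfloor>\<close> of the target point is constant on each of the \<open>n\<close> cells of \<open>[0, 1)\<close>, which
reduces integrals along the transport plan to finite sums.\<close>

lemma nn_integral_cells:
  fixes H :: "nat \<Rightarrow> real \<Rightarrow> ennreal"
  assumes [measurable]: "\<And>i. H i \<in> borel_measurable borel" and n: "n > 0"
  shows "(\<integral>\<^sup>+s. H (nat \<lfloor>real n * s\<rfloor>) s * indicator {0..<1} s \<partial>lborel)
    = (\<Sum>i<n. \<integral>\<^sup>+s. H i s * indicator {real i / n..<real (Suc i) / n} s \<partial>lborel)"
proof -
  have "H (nat \<lfloor>real n * s\<rfloor>) s * indicator {0..<1} s
      = (\<Sum>i<n. H i s * indicator {real i / n..<real (Suc i) / n} s)" for s
  proof -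
    have cell: "s \<in> {real i / n..<real (Suc i) / n} \<longleftrightarrow> real i \<le> real n * s \<and> real n * s < real i + 1" for i
      using n by (simp add: field_simps)
    show ?thesis
    proof (cases "s \<in> {0..<1}")
      case True
      then have s: "0 \<le> s" "s < 1" by auto
      define j where "j = nat \<lfloor>real n * s\<rfloor>"
      have "0 \<le> real n * s" "real n * s < real n" using s n by auto
      then have j: "real j \<le> real n * s" "real n * s < real j + 1" "j < n"
        unfolding j_def by linarith+
      have "s \<in> {real i / n..<real (Suc i) / n} \<longleftrightarrow> i = j" for i
        unfolding cell using j by linarith
      then have "(\<Sum>i<n. H i s * indicator {real i / n..<real (Suc i) / n} s) = (\<Sum>i<n. if i = j then H j s else 0)"
        by (intro sum.cong refl) (auto simp: indicator_def)
      also have "\<dots> = H j s" using j(3) by simp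
      finally show ?thesis using True by (simp add: j_def)
    next
      case False
      have out: "s \<notin> {real i / n..<real (Suc i) / n}" if "i < n" for i
      proof
        assume "s \<in> {real i / n..<real (Suc i) / n}"
        then have *: "real i \<le> real n * s" "real n * s < real i + 1" by (simp_all only: cell)
        from *(1) have "0 \<le> real n * s" by linarith
        then have "0 \<le> s" using n by (simp add: zero_le_mult_iff)
        moreover have "real n * s < real n" using *(2) that by linarith
        then have "s < 1" using n by simp
        ultimately show False using False by simp
      qed
      have "(\<Sum>i<n. H i s * indicator {real i / n..<real (Suc i) / n} s) = 0"
        by (intro sum.neutral ballI) (simp only: lessThan_iff indicator_simps(2)[OF out] mult_zero_right)
      then show ?thesis using False by (simp only: indicator_simps(2)[OF False] mult_zero_right)
    qed
  qed
  then have "(\<integral>\<^sup>+s. H (nat \<lfloor>real n * s\<rfloor>) s * indicator {0..<1} s \<partial>lborel)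
      = (\<integral>\<^sup>+s. (\<Sum>i<n. H i s * indicator {real i / n..<real (Suc i) / n} s) \<partial>lborel)"
    by (simp only:)
  also have "\<dots> = (\<Sum>i<n. \<integral>\<^sup>+s. H i s * indicator {real i / n..<real (Suc i) / n} s \<partial>lborel)"
    by (rule nn_integral_sum) measurable
  finally show ?thesis .
qed

lemma dist_to_torus_le: "dist (to_torus s) (to_torus t) \<le> \<bar>s - t\<bar>"
  using dist_to_int_le[of "s - t" 0] by (simp add: dist_torus.abs_eq)

lemma wasserstein2_le_coupling:
  assumes "\<gamma> \<in> couplings \<mu> \<nu>"
    and "(\<integral>\<^sup>+z. ennreal ((dist (fst z) (snd z))\<^sup>2) \<partial>\<gamma>) \<le> ennreal c" and "c \<ge> 0"
  shows "wasserstein2 \<mu> \<nu> \<le> ennreal (sqrt c)"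
proof -
  define I where "I = (INF \<gamma>\<in>couplings \<mu> \<nu>. \<integral>\<^sup>+z. ennreal ((dist (fst z) (snd z))\<^sup>2) \<partial>\<gamma>)"
  have "I \<le> ennreal c" unfolding I_def using assms(1,2) by (rule INF_lower2)
  moreover from this have "I \<noteq> \<infinity>" by (auto simp: top_unique)
  ultimately have "enn2real I \<le> c" using assms(3) by (metis enn2real_leI)
  then show ?thesis
    using \<open>I \<noteq> \<infinity>\<close> by (simp add: wasserstein2_def I_def[symmetric] ennreal_leI)
qed

text \<open>The plan moves \<open>s + a\<close> to the sorted point with index \<open>\<lfloor>n s\<rfloor>\<close>, for \<open>s\<close> uniform in \<open>[0, 1)\<close>.  The
second marginal is uniform for every offset \<open>a\<close> by translation invariance.  Distances on the torus
are bounded by distances of real representatives, so the cost is at most that of the same plan on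
the line, which \<open>staircase_cost_eq_energy\<close> evaluates.\<close>

lemma wasserstein2_empirical_le_energy:
  assumes n: "n \<ge> 1"
  shows "wasserstein2 (empirical_measure x n) torus_measure
    \<le> ennreal (sqrt ((\<Sum>k=1..n. \<Sum>l=1..n. periodic_bernoulli (x k - x l)) / (2 * (real n)\<^sup>2)))"
proof -
  have n0: "n > 0" using n by simp
  have "\<forall>k. \<exists>s. 0 \<le> s \<and> s < 1 \<and> to_torus s = x k"
    using torus_representative by metis
  then obtain r where r: "\<And>k. 0 \<le> r k" "\<And>k. r k < 1" "\<And>k. to_torus (r k) = x k"
    by metis
  obtain y where mono: "mono_on {..<n} y"
    and perm: "image_mset y (mset_set {..<n}) = image_mset r (mset_set {1..n})"
    by (rule sorted_enumeration)
  \<comment> \<open>The interval \<open>[a, a + 1)\<close> has midpoint \<open>a + 1/2\<close>, which is thus the mean of the points.\<close>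
  define a where "a = (\<Sum>i<n. y i) / n - 1 / 2"
  define z where "z i = y i - (\<Sum>i<n. y i) / n" for i
  define M :: "real measure" where "M = restrict_space lborel {0..<1}"
  define T where "T s = (to_torus (y (nat \<lfloor>real n * s\<rfloor>)), to_torus (s + a))" for s
  define \<gamma> where "\<gamma> = distr M borel T"
  have T: "T \<in> measurable M borel"
  proof -
    \<comment> \<open>Measurability is checked in the plane, and then carried to the product of tori by a
      continuous map: the Borel sets of that product are those of the product topology.\<close>
    have step: "(\<lambda>s. (y (nat \<lfloor>real n * s\<rfloor>), s + a)) \<in> borel_measurable borel" by measurable
    have proj: "(\<lambda>w. (to_torus (fst w), to_torus (snd w))) \<in> borel_measurable borel"
      by (intro borel_measurable_continuous_onI continuous_on_Pair
          continuous_on_compose2[OF continuous_on_to_torus] continuous_intros) auto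
    have "T \<in> borel_measurable borel"
      using measurable_compose[OF step proj] by (simp add: T_def[abs_def])
    then show ?thesis unfolding M_def by (intro measurable_restrict_space1) simp
  qed
  have proj: "fst \<in> borel_measurable (borel :: (torus \<times> torus) measure)"
    "snd \<in> borel_measurable (borel :: (torus \<times> torus) measure)"
    by (intro borel_measurable_continuous_onI continuous_intros)+
  have nnM: "(\<integral>\<^sup>+s. g s \<partial>M) = (\<integral>\<^sup>+s. g s * indicator {0..<1} s \<partial>lborel)" for g :: "real \<Rightarrow> ennreal"
    unfolding M_def by (simp add: nn_integral_restrict_space)
  have fst: "distr \<gamma> borel fst = empirical_measure x n"
  proof (rule measure_eqI)
    show "sets (distr \<gamma> borel fst) = sets (empirical_measure x n)"
      by (simp add: empirical_measure_def)
  next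
    fix A assume "A \<in> sets (distr \<gamma> borel fst)"
    then have A [measurable]: "A \<in> sets borel" by simp
    have m: "(\<lambda>s. to_torus (y (nat \<lfloor>real n * s\<rfloor>))) \<in> measurable M borel"
      using measurable_comp[OF T proj(1)] by (simp add: comp_def T_def)
    have "distr \<gamma> borel fst = distr M borel (\<lambda>s. to_torus (y (nat \<lfloor>real n * s\<rfloor>)))"
      unfolding \<gamma>_def by (subst distr_distr[OF proj(1) T]) (simp add: comp_def T_def)
    then have "emeasure (distr \<gamma> borel fst) A
        = (\<integral>\<^sup>+u. indicator A u \<partial>distr M borel (\<lambda>s. to_torus (y (nat \<lfloor>real n * s\<rfloor>))))"
      by simp
    also have "\<dots> = (\<integral>\<^sup>+s. indicator A (to_torus (y (nat \<lfloor>real n * s\<rfloor>))) \<partial>M)"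
      by (rule nn_integral_distr[OF m]) simp
    also have "\<dots> = (\<Sum>i<n. \<integral>\<^sup>+s. indicator A (to_torus (y i)) * indicator {real i / n..<real (Suc i) / n} s \<partial>lborel)"
      unfolding nnM
      by (rule nn_integral_cells[where H = "\<lambda>i s. indicator A (to_torus (y i))", OF _ n0]) simp
    also have "\<dots> = (\<Sum>i<n. indicator A (to_torus (y i)) * ennreal (1 / n))"
      by (simp add: nn_integral_cmult_indicator divide_right_mono diff_divide_distrib[symmetric])
    also have "\<dots> = (\<Sum>k=1..n. indicator A (to_torus (r k)) * ennreal (1 / n))"
      by (rule sum_image_mset_eq[OF perm])
    also have "\<dots> = (\<Sum>k=1..n. indicator A (x k)) / of_nat n"
      using n0 by (simp add: r(3) sum_distrib_right[symmetric] divide_ennreal_def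
          ennreal_of_nat_eq_real_of_nat inverse_ennreal inverse_eq_divide)
    also have "\<dots> = emeasure (empirical_measure x n) A"
      using n by (simp add: emeasure_empirical_measure A)
    finally show "emeasure (distr \<gamma> borel fst) A = emeasure (empirical_measure x n) A" .
  qed
  have snd: "distr \<gamma> borel snd = torus_measure"
  proof -
    have m: "to_torus \<in> measurable M borel"
      unfolding M_def by (intro measurable_restrict_space1) simp
    have "distr \<gamma> borel snd = distr M borel (\<lambda>s. to_torus s + to_torus a)"
      unfolding \<gamma>_def by (subst distr_distr[OF proj(2) T]) (simp add: comp_def T_def to_torus_add)
    also have "\<dots> = distr (distr M borel to_torus) borel (\<lambda>u. u + to_torus a)"
      by (subst distr_distr[OF _ m]) (simp_all add: comp_def)
    also have "\<dots> = torus_measure"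
      using torus_measure_translate by (simp add: M_def torus_measure_def)
    finally show ?thesis .
  qed
  have coupling: "\<gamma> \<in> couplings (empirical_measure x n) torus_measure"
    by (simp add: couplings_def fst snd) (simp add: \<gamma>_def)
  have cell_cost: "(\<integral>\<^sup>+s. ennreal ((s + a - y i)\<^sup>2) * indicator {real i / n..<real (Suc i) / n} s \<partial>lborel)
      \<le> ennreal (((real (Suc i) / n - 1 / 2 - z i) ^ 3 - (real i / n - 1 / 2 - z i) ^ 3) / 3)" for i
  proof -
    have "(\<integral>\<^sup>+s. ennreal ((s + a - y i)\<^sup>2) * indicator {real i / n..<real (Suc i) / n} s \<partial>lborel)
        \<le> (\<integral>\<^sup>+s. ennreal ((s + a - y i)\<^sup>2) * indicator {real i / n..real (Suc i) / n} s \<partial>lborel)"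
      by (intro nn_integral_mono) (auto simp: indicator_def)
    also have "\<dots> = ennreal ((real (Suc i) / n + a - y i) ^ 3 / 3 - (real i / n + a - y i) ^ 3 / 3)"
      by (rule nn_integral_FTC_Icc) (auto intro!: derivative_eq_intros divide_right_mono)
    also have "real (Suc i) / n + a - y i = real (Suc i) / n - 1 / 2 - z i" by (simp add: a_def z_def)
    also have "real i / n + a - y i = real i / n - 1 / 2 - z i" by (simp add: a_def z_def)
    finally show ?thesis by (simp add: diff_divide_distrib)
  qed
  have cube_mono: "0 \<le> ((real (Suc i) / n - 1 / 2 - z i) ^ 3 - (real i / n - 1 / 2 - z i) ^ 3) / 3" for i
    by (simp add: power_mono_odd divide_right_mono)
  define E where "E = (\<Sum>k=1..n. \<Sum>l=1..n. periodic_bernoulli (x k - x l)) / (2 * (real n)\<^sup>2)"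
  have E: "(\<Sum>i<n. ((real (Suc i) / n - 1 / 2 - z i) ^ 3 - (real i / n - 1 / 2 - z i) ^ 3) / 3) = E"
  proof -
    let ?q = "\<lambda>s t :: real. (s - t)\<^sup>2 - \<bar>s - t\<bar> + 1 / 6"
    have "mono_on {..<n} z" using mono by (simp add: mono_on_def z_def)
    moreover have "(\<Sum>i<n. z i) = 0" using n0 by (simp add: z_def sum_subtractf)
    ultimately have "(\<Sum>i<n. ((real (Suc i) / n - 1 / 2 - z i) ^ 3 - (real i / n - 1 / 2 - z i) ^ 3) / 3)
        = (\<Sum>i<n. \<Sum>j<n. ?q (z i) (z j)) / (2 * (real n)\<^sup>2)"
      using n0 by (rule staircase_cost_eq_energy)
    also have "(\<Sum>i<n. \<Sum>j<n. ?q (z i) (z j)) = (\<Sum>i<n. \<Sum>j<n. ?q (y i) (y j))"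
      by (simp add: z_def)
    also have "\<dots> = (\<Sum>i<n. \<Sum>l=1..n. ?q (y i) (r l))"
      by (intro sum.cong refl sum_image_mset_eq[OF perm])
    also have "\<dots> = (\<Sum>k=1..n. \<Sum>l=1..n. ?q (r k) (r l))"
      by (rule sum_image_mset_eq[OF perm])
    also have "\<dots> = (\<Sum>k=1..n. \<Sum>l=1..n. periodic_bernoulli (x k - x l))"
    proof (intro sum.cong refl)
      fix k l
      have "\<bar>r k - r l\<bar> \<le> 1" using r(1,2)[of k] r(1,2)[of l] by linarith
      then show "?q (r k) (r l) = periodic_bernoulli (x k - x l)"
        using periodic_bernoulli_to_torus[of "r k - r l"] by (simp add: to_torus_diff r(3))
    qed
    finally show ?thesis by (simp add: E_def)
  qed
  have "(\<integral>\<^sup>+w. ennreal ((dist (fst w) (snd w))\<^sup>2) \<partial>\<gamma>)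
      = (\<integral>\<^sup>+s. ennreal ((dist (to_torus (y (nat \<lfloor>real n * s\<rfloor>))) (to_torus (s + a)))\<^sup>2) \<partial>M)"
    unfolding \<gamma>_def
    by (subst nn_integral_distr[OF T])
      (auto simp: T_def intro!: borel_measurable_continuous_onI continuous_intros)
  also have "\<dots> \<le> (\<integral>\<^sup>+s. ennreal ((s + a - y (nat \<lfloor>real n * s\<rfloor>))\<^sup>2) \<partial>M)"
  proof (intro nn_integral_mono ennreal_leI)
    fix s
    show "(dist (to_torus (y (nat \<lfloor>real n * s\<rfloor>))) (to_torus (s + a)))\<^sup>2 \<le> (s + a - y (nat \<lfloor>real n * s\<rfloor>))\<^sup>2"
      using power_mono[OF dist_to_torus_le[of "s + a" "y (nat \<lfloor>real n * s\<rfloor>)"], of 2]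
      by (simp add: dist_commute)
  qed
  also have "\<dots> = (\<Sum>i<n. \<integral>\<^sup>+s. ennreal ((s + a - y i)\<^sup>2) * indicator {real i / n..<real (Suc i) / n} s \<partial>lborel)"
    unfolding nnM
    by (rule nn_integral_cells[where H = "\<lambda>i s. ennreal ((s + a - y i)\<^sup>2)", OF _ n0]) measurable
  also have "\<dots> \<le> (\<Sum>i<n. ennreal (((real (Suc i) / n - 1 / 2 - z i) ^ 3 - (real i / n - 1 / 2 - z i) ^ 3) / 3))"
    by (intro sum_mono cell_cost)
  also have "\<dots> = ennreal E"
    by (subst sum_ennreal[OF cube_mono]) (simp only: E)
  finally have cost: "(\<integral>\<^sup>+w. ennreal ((dist (fst w) (snd w))\<^sup>2) \<partial>\<gamma>) \<le> ennreal E" .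
  have "0 \<le> E" unfolding E[symmetric] by (intro sum_nonneg cube_mono)
  show ?thesis
    using wasserstein2_le_coupling[OF coupling cost \<open>0 \<le> E\<close>] by (simp only: E_def)
qed

section \<open>Energy of greedy sequences\<close>

text \<open>The form with weights \<open>1, -1\<close> at the points \<open>t, 0\<close> is \<open>2 f(0) - 2 f(t)\<close>.\<close>

lemma positive_definite_le_at_zero:
  assumes f: "continuous_on UNIV f" and nonneg: "\<And>k. Re (fourier_coeff f k) \<ge> 0"
    and even: "\<And>t. f (- t) = f t"
  shows "f t \<le> f 0"
proof -
  have "0 \<le> (\<Sum>a\<in>{False, True}. \<Sum>b\<in>{False, True}. (if a then 1 else - 1) * (if b then 1 else - 1)
      * f ((if a then t else 0) - (if b then t else 0)))"
    by (rule nonneg_fourier_imp_positive_definite[OF f nonneg])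
  then show ?thesis by (simp add: even)
qed

text \<open>A minimum is at most the mean, and every translate of \<open>g\<close> has mean zero.\<close>

lemma arg_min_sum_translates_nonpos:
  fixes g :: "torus \<Rightarrow> real"
  assumes g: "continuous_on UNIV g" and mean: "(\<integral>u. g u \<partial>torus_measure) = 0"
    and min: "is_arg_min (\<lambda>t. \<Sum>k\<in>I. g (t - x k)) (\<lambda>_. True) p"
  shows "(\<Sum>k\<in>I. g (p - x k)) \<le> 0"
proof -
  have c: "continuous_on UNIV (\<lambda>t. g (t - x k))" for k
    using continuous_on_torus_comp[OF g continuous_on_torus_translate, of "- x k"] by simp
  have i: "(\<integral>t. g (t - x k) \<partial>torus_measure) = 0" for k
    using integral_torus_translate[OF g, of "- x k"] mean by simp
  have "(\<Sum>k\<in>I. g (p - x k)) = (\<integral>t. (\<Sum>k\<in>I. g (p - x k)) \<partial>torus_measure)"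
    using torus.prob_space by simp
  also have "\<dots> \<le> (\<integral>t. (\<Sum>k\<in>I. g (t - x k)) \<partial>torus_measure)"
    using min by (intro integral_mono integrable_torus continuous_intros c)
      (auto simp: is_arg_min_def not_less)
  also have "\<dots> = 0"
    by (simp add: integrable_torus c i Bochner_Integration.integral_sum)
  finally show ?thesis .
qed

text \<open>Up to \<open>m\<close> points nothing is known about their position, and the energy is bounded by its \<open>n\<^sup>2\<close> terms,
each at most \<open>g(0)\<close>; here \<open>n\<^sup>2 \<le> m n\<close>.  Every later point adds at most \<open>g(0)\<close>.  The maximum with \<open>1\<close>
covers an empty initial set.\<close>

lemma greedy_energy_le:
  fixes g :: "torus \<Rightarrow> real"
  assumes g: "continuous_on UNIV g" and mean: "(\<integral>u. g u \<partial>torus_measure) = 0"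
    and even: "\<And>t. g (- t) = g t" and le: "\<And>t. g t \<le> g 0" and nonneg: "0 \<le> g 0"
    and min: "\<And>n. n > m \<Longrightarrow> is_arg_min (\<lambda>t. \<Sum>k=1..n-1. g (t - x k)) (\<lambda>_. True) (x n)"
  shows "(\<Sum>k=1..n. \<Sum>l=1..n. g (x k - x l)) \<le> max 1 (real m) * real n * g 0"
proof (induction n)
  case (Suc n)
  show ?case
  proof (cases "Suc n \<le> m")
    case True
    have "(\<Sum>k=1..Suc n. \<Sum>l=1..Suc n. g (x k - x l)) \<le> (\<Sum>k=1..Suc n. \<Sum>l=1..Suc n. g 0)"
      by (intro sum_mono le)
    also have "\<dots> = real (Suc n) * (real (Suc n) * g 0)" by simp
    also have "\<dots> \<le> max 1 (real m) * (real (Suc n) * g 0)"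
      using True nonneg by (intro mult_right_mono) auto
    finally show ?thesis by (simp only: mult.assoc)
  next
    case False
    have new: "(\<Sum>k=1..n. g (x (Suc n) - x k)) \<le> 0"
      using arg_min_sum_translates_nonpos[OF g mean min[of "Suc n"]] False by simp
    have sym: "(\<Sum>k=1..n. g (x k - x (Suc n))) = (\<Sum>k=1..n. g (x (Suc n) - x k))"
      by (intro sum.cong refl) (metis even minus_diff_eq)
    have "(\<Sum>k=1..Suc n. \<Sum>l=1..Suc n. g (x k - x l))
        = (\<Sum>k=1..n. \<Sum>l=1..n. g (x k - x l)) + 2 * (\<Sum>k=1..n. g (x (Suc n) - x k)) + g 0"
      by (simp add: sum.distrib sym del: One_nat_def)
    also have "\<dots> \<le> max 1 (real m) * real n * g 0 + 1 * g 0"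
      using new Suc.IH by linarith
    also have "\<dots> \<le> max 1 (real m) * real n * g 0 + max 1 (real m) * g 0"
      using nonneg by (intro add_left_mono mult_right_mono) auto
    finally show ?thesis by (simp add: algebra_simps)
  qed
qed simp

text \<open>The decay hypothesis is used in the form that \<open>2\<pi>\<^sup>2c B\<close> lies below \<open>f\<close> in the order
given by Fourier coefficients, once the mean of \<open>f\<close> is removed.  The factor \<open>2\<pi>\<^sup>2\<close> normalises the
coefficients of \<open>B\<close> to \<open>1/k\<^sup>2\<close>.\<close>

lemma greedy_bernoulli_energy_le:
  fixes f :: "torus \<Rightarrow> real"
  assumes c: "c > 0" and f: "continuous_on UNIV f" and even: "\<And>t. f (- t) = f t"
    and decay: "\<And>k :: int. k \<noteq> 0 \<Longrightarrow> Re (fourier_coeff f k) \<ge> c / (of_int k)\<^sup>2"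
    and min: "\<And>n. n > m \<Longrightarrow> is_arg_min (\<lambda>t. \<Sum>k=1..n-1. f (t - x k)) (\<lambda>_. True) (x n)"
  shows "0 \<le> f 0 - Re (fourier_coeff f 0)"
    and "2 * pi\<^sup>2 * c * (\<Sum>k=1..n. \<Sum>l=1..n. periodic_bernoulli (x k - x l))
      \<le> max 1 (real m) * real n * (f 0 - Re (fourier_coeff f 0))"
proof -
  define g where "g u = f u - Re (fourier_coeff f 0)" for u
  have g: "continuous_on UNIV g" unfolding g_def by (intro continuous_intros f)
  have coeff: "Re (fourier_coeff g k) = (if k = 0 then 0 else Re (fourier_coeff f k))" for k
    using Re_fourier_coeff_diff_const[OF f, of "Re (fourier_coeff f 0)" k] by (simp add: g_def[abs_def])
  have coeff_nonneg: "Re (fourier_coeff g k) \<ge> 0" for k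
    using decay[of k] c by (auto simp: coeff intro: order_trans[rotated])
  have even_g: "g (- t) = g t" for t by (simp add: g_def even)
  have le: "g t \<le> g 0" for t
    using positive_definite_le_at_zero[OF g coeff_nonneg even_g] .
  have mean: "(\<integral>u. g u \<partial>torus_measure) = 0"
    using Re_fourier_coeff[OF g, of 0] coeff[of 0] by simp
  have "(\<integral>u. g u \<partial>torus_measure) \<le> (\<integral>u. g 0 \<partial>torus_measure)"
    by (intro integral_mono integrable_torus g continuous_intros le)
  then have nonneg: "0 \<le> g 0" using torus.prob_space by (simp add: mean)
  then show "0 \<le> f 0 - Re (fourier_coeff f 0)" by (simp add: g_def)
  have min_g: "is_arg_min (\<lambda>t. \<Sum>k=1..n-1. g (t - x k)) (\<lambda>_. True) (x n)" if "n > m" for n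
    using min[OF that] by (simp add: is_arg_min_def g_def sum_subtractf)
  let ?\<phi> = "\<lambda>u. g u - 2 * pi\<^sup>2 * c * periodic_bernoulli u"
  have "continuous_on UNIV ?\<phi>"
    by (intro continuous_intros g continuous_on_periodic_bernoulli)
  moreover have "Re (fourier_coeff ?\<phi> k) \<ge> 0" for k
    using decay[of k]
    by (subst Re_fourier_coeff_diff_cmult[OF g continuous_on_periodic_bernoulli])
      (auto simp: coeff Re_fourier_coeff_periodic_bernoulli)
  ultimately have "0 \<le> (\<Sum>k=1..n. \<Sum>l=1..n. 1 * 1 * ?\<phi> (x k - x l))"
    by (rule nonneg_fourier_imp_positive_definite)
  then have "2 * pi\<^sup>2 * c * (\<Sum>k=1..n. \<Sum>l=1..n. periodic_bernoulli (x k - x l))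
      \<le> (\<Sum>k=1..n. \<Sum>l=1..n. g (x k - x l))"
    by (simp add: sum_subtractf sum_distrib_left)
  also have "\<dots> \<le> max 1 (real m) * real n * g 0"
    by (rule greedy_energy_le[OF g mean even_g le nonneg min_g])
  finally show "2 * pi\<^sup>2 * c * (\<Sum>k=1..n. \<Sum>l=1..n. periodic_bernoulli (x k - x l))
      \<le> max 1 (real m) * real n * (f 0 - Re (fourier_coeff f 0))" by (simp add: g_def)
qed

lemma greedy_wasserstein2_le:
  fixes f :: "torus \<Rightarrow> real"
  assumes c: "c > 0" and f: "continuous_on UNIV f" and even: "\<And>t. f (- t) = f t"
    and decay: "\<And>k :: int. k \<noteq> 0 \<Longrightarrow> Re (fourier_coeff f k) \<ge> c / (of_int k)\<^sup>2"
    and min: "\<And>n. n > m \<Longrightarrow> is_arg_min (\<lambda>t. \<Sum>k=1..n-1. f (t - x k)) (\<lambda>_. True) (x n)"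
    and K: "f 0 - Re (fourier_coeff f 0) \<le> K" and n: "n \<ge> 1"
  shows "wasserstein2 (empirical_measure x n) torus_measure
    \<le> ennreal (sqrt (max 1 (real m) * K / (4 * pi\<^sup>2 * c)) / sqrt (real n))"
proof -
  let ?B = "\<Sum>k=1..n. \<Sum>l=1..n. periodic_bernoulli (x k - x l)"
  have "2 * pi\<^sup>2 * c * ?B \<le> max 1 (real m) * real n * (f 0 - Re (fourier_coeff f 0))"
    by (rule greedy_bernoulli_energy_le(2)[OF c f even decay min])
  also have "\<dots> \<le> max 1 (real m) * real n * K"
    using K by (intro mult_left_mono) auto
  finally have "?B \<le> max 1 (real m) * real n * K / (2 * pi\<^sup>2 * c)"
    using c by (simp add: pos_le_divide_eq mult.commute)
  then have "?B / (2 * (real n)\<^sup>2) \<le> max 1 (real m) * real n * K / (2 * pi\<^sup>2 * c) / (2 * (real n)\<^sup>2)"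
    by (intro divide_right_mono) auto
  also have "\<dots> = max 1 (real m) * K / (4 * pi\<^sup>2 * c) / real n"
    using n c by (simp add: power2_eq_square)
  finally have "sqrt (?B / (2 * (real n)\<^sup>2)) \<le> sqrt (max 1 (real m) * K / (4 * pi\<^sup>2 * c)) / sqrt (real n)"
    by (simp only: real_sqrt_divide[symmetric] real_sqrt_le_iff)
  then show ?thesis
    using wasserstein2_empirical_le_energy[OF n, of x] by (meson ennreal_leI order_trans)
qed

text \<open>
The constant is the one of \<open>greedy_wasserstein2_le\<close> with absolute values and an added \<open>1\<close>, so that it
is positive for all arguments.  If the mean of \<open>f\<close> is nonnegative, then \<open>f(0)\<close> is an upper bound for
\<open>f(0)\<close> minus the mean, which gives the second estimate.
\<close>

theorem theorem1:
  shows "\<exists>C :: torus set \<Rightarrow> real \<Rightarrow> real \<Rightarrow> real.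
    (\<forall>A K c. C A K c > 0) \<and>
    (\<forall>(A :: torus set) (c :: real) (f :: torus \<Rightarrow> real) (x :: nat \<Rightarrow> torus).
      c > 0 \<longrightarrow>
      continuous_on UNIV f \<longrightarrow>
      (\<forall>t. f (- t) = f t) \<longrightarrow>
      (\<forall>k :: int. k \<noteq> 0 \<longrightarrow> Re (fourier_coeff f k) \<ge> c * \<bar>real_of_int k\<bar> powi (- 2)) \<longrightarrow>
      finite A \<longrightarrow>
      x ` {1..card A} = A \<longrightarrow>
      (\<forall>n > card A. is_arg_min (\<lambda>t. \<Sum>k=1..n-1. f (t - x k)) (\<lambda>_. True) (x n)) \<longrightarrow>
      (\<forall>n \<ge> 1. wasserstein2 (empirical_measure x n) torus_measure
          \<le> ennreal (C A (f 0 - Re (fourier_coeff f 0)) c / sqrt (real n))) \<and>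
      (Re (fourier_coeff f 0) \<ge> 0 \<longrightarrow>
        (\<forall>n \<ge> 1. wasserstein2 (empirical_measure x n) torus_measure
          \<le> ennreal (C A (f 0) c / sqrt (real n)))))"
proof -
  define C :: "torus set \<Rightarrow> real \<Rightarrow> real \<Rightarrow> real"
    where "C A K c = 1 + sqrt (max 1 (real (card A)) * \<bar>K\<bar> / (4 * pi\<^sup>2 * \<bar>c\<bar>))" for A K c
  have C_pos: "C A K c > 0" for A K c
    unfolding C_def by (intro add_pos_nonneg) auto
  have bound: "wasserstein2 (empirical_measure x n) torus_measure \<le> ennreal (C A K c / sqrt (real n))"
    if c: "c > 0" and f: "continuous_on UNIV f" and even: "\<forall>t. f (- t) = f t"
      and decay: "\<forall>k :: int. k \<noteq> 0 \<longrightarrow> Re (fourier_coeff f k) \<ge> c * \<bar>real_of_int k\<bar> powi (- 2)"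
      and min: "\<forall>n > card A. is_arg_min (\<lambda>t. \<Sum>k=1..n-1. f (t - x k)) (\<lambda>_. True) (x n)"
      and K: "f 0 - Re (fourier_coeff f 0) \<le> K" and n: "n \<ge> 1"
    for A c K n and f :: "torus \<Rightarrow> real" and x :: "nat \<Rightarrow> torus"
  proof -
    have decay': "Re (fourier_coeff f k) \<ge> c / (of_int k)\<^sup>2" if "k \<noteq> 0" for k
      using decay that by (simp add: power_int_minus divide_inverse)
    have min': "is_arg_min (\<lambda>t. \<Sum>k=1..n-1. f (t - x k)) (\<lambda>_. True) (x n)" if "n > card A" for n
      using min that by blast
    have "0 \<le> f 0 - Re (fourier_coeff f 0)"
      using greedy_bernoulli_energy_le(1)[where m = "card A" and x = x, OF c f] even decay' min' by blast
    then have "0 \<le> K" using K by linarith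
    then have "sqrt (max 1 (real (card A)) * K / (4 * pi\<^sup>2 * c)) / sqrt (real n) \<le> C A K c / sqrt (real n)"
      using c by (intro divide_right_mono) (auto simp: C_def)
    moreover have "wasserstein2 (empirical_measure x n) torus_measure
        \<le> ennreal (sqrt (max 1 (real (card A)) * K / (4 * pi\<^sup>2 * c)) / sqrt (real n))"
      using even decay' min' K n by (intro greedy_wasserstein2_le[OF c f]) auto
    ultimately show ?thesis
      by (meson ennreal_leI order_trans)
  qed
  show ?thesis
    by (intro exI[of _ C] conjI allI impI C_pos; rule bound; assumption?; simp)
qed

end
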